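(* For every $p>0$ and every $n\ge0$, $H_p^{gl}(2_n)=0$, where $2_n$ is the free $\omega$-category generated by one $n$-dimensional morphism.
   Context: **$\omega$-categories.** An $\omega$-category is a strict globular $\omega$-category in one-set form: a set $\mathcal C$ with operations $( *_n,s_n,t_n)_{n\ge0}$, each $(\mathcal C,*_n,s_n,t_n)$ being a category ($x*_ny$ is defined iff $t_nx=s_ny$), each pair $m<n$ giving a strict 2-category, and such that each $x$ satisfies $s_nx=t_nx=x$ for some $n$; the least such $n$ is the dimension of $x$. $\mathcal C_n$ is the set of morphisms of dimension exactly $n$. $\mathcal C$ is *non-contracting* if $s_1x,t_1x$ have dimension exactly $1$ whenever $\dim x>0$ ($2_n$ is non-contracting). Then $\mathbb P\mathcal C$ is the $\omega$-category of all morphisms of $\mathcal C$ of dimension $>0$, with $*_i^{\mathbb P\mathcal C}=*_{i+1}^{\mathcal C}$, $s_i^{\mathbb P\mathcal C}=s_{i+1}^{\mathcal C}$, $t_i^{\mathbb P\mathcal C}=t_{i+1}^{\mathcal C}$. **$\Delta^n$.** Faces of the $n$-simplex are non-empty strictly increasing sequences $(\sigma_0\dots\sigma_r)$ in $\{0,\dots,n\}$, of dimension $r$. $R(x)$ is the set of subfaces of a face $x$ (including $x$), $R(X)=\bigcup_{x\in X}R(x)$. $\Delta^n$ is the free $\omega$-category generated by the $R(x)$ with the rules: for $x$ of dimension $p\ge1$, $s_{p-1}R(x)=R(s_x)$, $t_{p-1}R(x)=R(t_x)$, where $s_x$ (resp. $t_x$) is the set of faces obtained from $x$ by removing one element in odd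 (resp. even) position (positions counted from 1); and if $t_p(X)=s_p(Y)$, then $X\cup Y\in\Delta^n$ and $X*_pY=X\cup Y$. Write $x(\sigma)$ for $x(R(\sigma))$. **Globular homology.** The globular nerve of a non-contracting $\mathcal C$ is the augmented simplicial set $\mathcal N^{gl}_n(\mathcal C)=\omega Cat(\Delta^n,\mathbb P\mathcal C)$ (the set of $\omega$-functors) for $n\ge0$, with $(\partial_ix)(\sigma)=x(\delta_i\sigma)$, $(\epsilon_ix)(\sigma)=x(\eta_i\sigma)$, where $\delta_i$ is the increasing injection missing $i$ and $\eta_i$ the non-decreasing surjection hitting $i$ twice; $\mathcal N^{gl}_{-1}(\mathcal C)=\mathcal C_0\times\mathcal C_0$, with augmentation $\partial_{-1}x=(s_0x,t_0x)$ on $\mathcal N^{gl}_0(\mathcal C)=\mathcal C_1$. For $n\ge-1$, $H^{gl}_{n+1}(\mathcal C)=H_n(\mathcal N^{gl}(\mathcal C))$, where for an augmented simplicial set $X$, $H_n(X)$ is the usual simplicial homology for $n\ge1$, $H_0(X)=\ker(\partial_{-1}:\mathbb ZX_0\to\mathbb ZX_{-1})/\mathrm{Im}(\partial_0-\partial_1)$, $H_{-1}(X)=\mathbb ZX_{-1}/\mathrm{Im}(\partial_{-1})$. *)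

theory Defs
  imports "HOL-Algebra.Free_Abelian_Groups"
begin

section \<open>Strict globular omega-categories in one-set form\<close>

record 'a omega_cat = "'a partial_object" +
  ocomp :: "nat \<Rightarrow> 'a \<Rightarrow> 'a \<Rightarrow> 'a"
  osrc :: "nat \<Rightarrow> 'a \<Rightarrow> 'a"
  otgt :: "nat \<Rightarrow> 'a \<Rightarrow> 'a"

text \<open>
  The composite \<open>ocomp C n x y\<close> stands for \<open>x *\<^sub>n y\<close>; it is meaningful only when
  \<open>otgt C n x = osrc C n y\<close>, and nothing is assumed about its values otherwise.
\<close>

definition one_set_category ::
    "'a set \<Rightarrow> ('a \<Rightarrow> 'a \<Rightarrow> 'a) \<Rightarrow> ('a \<Rightarrow> 'a) \<Rightarrow> ('a \<Rightarrow> 'a) \<Rightarrow> bool" where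
  "one_set_category A m s t \<longleftrightarrow>
     (\<forall>x\<in>A. s x \<in> A \<and> t x \<in> A) \<and>
     (\<forall>x\<in>A. s (s x) = s x \<and> t (s x) = s x \<and> s (t x) = t x \<and> t (t x) = t x) \<and>
     (\<forall>x\<in>A. \<forall>y\<in>A. t x = s y \<longrightarrow> m x y \<in> A \<and> s (m x y) = s x \<and> t (m x y) = t y) \<and>
     (\<forall>x\<in>A. m (s x) x = x \<and> m x (t x) = x) \<and>
     (\<forall>x\<in>A. \<forall>y\<in>A. \<forall>z\<in>A. t x = s y \<longrightarrow> t y = s z \<longrightarrow> m (m x y) z = m x (m y z))"

text \<open>
  In the interchange law the three hypotheses force all four composites to exist.
\<close>

definition one_set_2category ::
    "'a set \<Rightarrow> ('a \<Rightarrow> 'a \<Rightarrow> 'a) \<Rightarrow> ('a \<Rightarrow> 'a) \<Rightarrow> ('a \<Rightarrow> 'a) \<Rightarrow>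
     ('a \<Rightarrow> 'a \<Rightarrow> 'a) \<Rightarrow> ('a \<Rightarrow> 'a) \<Rightarrow> ('a \<Rightarrow> 'a) \<Rightarrow> bool" where
  "one_set_2category A m0 s0 t0 m1 s1 t1 \<longleftrightarrow>
     one_set_category A m0 s0 t0 \<and> one_set_category A m1 s1 t1 \<and>
     (\<forall>x\<in>A. s0 (s1 x) = s0 x \<and> s0 (t1 x) = s0 x \<and> t0 (s1 x) = t0 x \<and> t0 (t1 x) = t0 x) \<and>
     (\<forall>x\<in>A. s1 (s0 x) = s0 x \<and> t1 (s0 x) = s0 x \<and> s1 (t0 x) = t0 x \<and> t1 (t0 x) = t0 x) \<and>
     (\<forall>x\<in>A. \<forall>y\<in>A. t0 x = s0 y \<longrightarrow>
        s1 (m0 x y) = m0 (s1 x) (s1 y) \<and> t1 (m0 x y) = m0 (t1 x) (t1 y)) \<and>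
     (\<forall>x\<in>A. \<forall>y\<in>A. t1 x = s1 y \<longrightarrow>
        s0 (m1 x y) = m1 (s0 x) (s0 y) \<and> t0 (m1 x y) = m1 (t0 x) (t0 y)) \<and>
     (\<forall>x\<in>A. \<forall>y\<in>A. \<forall>z\<in>A. \<forall>w\<in>A. t0 x = s0 y \<longrightarrow> t1 x = s1 z \<longrightarrow> t1 y = s1 w \<longrightarrow>
        m1 (m0 x y) (m0 z w) = m0 (m1 x z) (m1 y w))"

definition omega_category :: "('a, 'b) omega_cat_scheme \<Rightarrow> bool" where
  "omega_category C \<longleftrightarrow>
     (\<forall>n. one_set_category (carrier C) (ocomp C n) (osrc C n) (otgt C n)) \<and>
     (\<forall>m n. m < n \<longrightarrow> one_set_2category (carrier C)
        (ocomp C m) (osrc C m) (otgt C m) (ocomp C n) (osrc C n) (otgt C n)) \<and>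
     (\<forall>x\<in>carrier C. \<exists>n. osrc C n x = x \<and> otgt C n x = x)"

definition odim :: "('a, 'b) omega_cat_scheme \<Rightarrow> 'a \<Rightarrow> nat" where
  "odim C x = (LEAST n. osrc C n x = x \<and> otgt C n x = x)"

definition cells_of_dim :: "('a, 'b) omega_cat_scheme \<Rightarrow> nat \<Rightarrow> 'a set" where
  "cells_of_dim C n = {x \<in> carrier C. odim C x = n}"

definition non_contracting :: "('a, 'b) omega_cat_scheme \<Rightarrow> bool" where
  "non_contracting C \<longleftrightarrow>
     (\<forall>x\<in>carrier C. 0 < odim C x \<longrightarrow> odim C (osrc C 1 x) = 1 \<and> odim C (otgt C 1 x) = 1)"

definition path_omega_cat :: "('a, 'b) omega_cat_scheme \<Rightarrow> 'a omega_cat" where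
  "path_omega_cat C =
     \<lparr>carrier = {x \<in> carrier C. 0 < odim C x},
      ocomp = (\<lambda>i. ocomp C (Suc i)), osrc = (\<lambda>i. osrc C (Suc i)), otgt = (\<lambda>i. otgt C (Suc i))\<rparr>"

text \<open>Functors are taken extensional, so that each of them is a single HOL function.\<close>

definition omega_functors ::
    "('a, 'c) omega_cat_scheme \<Rightarrow> ('b, 'd) omega_cat_scheme \<Rightarrow> ('a \<Rightarrow> 'b) set" where
  "omega_functors A B = {f \<in> carrier A \<rightarrow>\<^sub>E carrier B.
     (\<forall>n. \<forall>x\<in>carrier A. f (osrc A n x) = osrc B n (f x) \<and> f (otgt A n x) = otgt B n (f x)) \<and>
     (\<forall>n. \<forall>x\<in>carrier A. \<forall>y\<in>carrier A. otgt A n x = osrc A n y \<longrightarrow>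
        f (ocomp A n x y) = ocomp B n (f x) (f y))}"


section \<open>The free omega-category on one n-dimensional morphism\<close>

text \<open>
  The generator is \<open>(n, True)\<close>; for \<open>k < n\<close> its \<open>k\<close>-source is \<open>(k, False)\<close> and its
  \<open>k\<close>-target is \<open>(k, True)\<close>. If \<open>x *\<^sub>k y\<close> is defined, then \<open>x\<close> or \<open>y\<close> is an identity for
  \<open>*\<^sub>k\<close>. The three lemmas at the end of the section confirm that this is an omega-category,
  that it is non-contracting, and that it has the universal property of the free
  omega-category on the \<open>n\<close>-dimensional morphism \<open>(n, True)\<close>.
\<close>

definition free_cell :: "nat \<Rightarrow> (nat \<times> bool) omega_cat" where
  "free_cell n =
     \<lparr>carrier = {..<n} \<times> UNIV \<union> {(n, True)},
      ocomp = (\<lambda>k x y. if fst x \<le> k then y else x),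
      osrc = (\<lambda>k x. if k < fst x then (k, False) else x),
      otgt = (\<lambda>k x. if k < fst x then (k, True) else x)\<rparr>"

lemma omega_category_free_cell: "omega_category (free_cell n)"
  unfolding omega_category_def one_set_2category_def one_set_category_def free_cell_def
  by (intro conjI allI impI; force split: if_splits)

lemma odim_free_cell: "odim (free_cell n) x = fst x"
  unfolding odim_def
proof (rule Least_equality)
  show "osrc (free_cell n) (fst x) x = x \<and> otgt (free_cell n) (fst x) x = x"
    by (simp add: free_cell_def)
next
  fix k assume "osrc (free_cell n) k x = x \<and> otgt (free_cell n) k x = x"
  then show "fst x \<le> k"
    by (cases x) (auto simp: free_cell_def split: if_splits)
qed

lemma non_contracting_free_cell: "non_contracting (free_cell n)"
  unfolding non_contracting_def odim_free_cell by (auto simp: free_cell_def)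

lemma free_cell_universal:
  assumes D: "omega_category D" and d: "d \<in> carrier D" "osrc D n d = d" "otgt D n d = d"
  shows "\<exists>!f. f \<in> omega_functors (free_cell n) D \<and> f (n, True) = d"
proof (rule ex1I)
  have cat: "one_set_category (carrier D) (ocomp D k) (osrc D k) (otgt D k)" for k
    using D unfolding omega_category_def by blast
  have closed: "osrc D k x \<in> carrier D" "otgt D k x \<in> carrier D" if "x \<in> carrier D" for k x
    using cat[of k] that unfolding one_set_category_def by blast+
  have unit: "ocomp D k (osrc D k x) x = x" "ocomp D k x (otgt D k x) = x"
    if "x \<in> carrier D" for k x
    using cat[of k] that unfolding one_set_category_def by blast+
  have idem: "osrc D k (osrc D k x) = osrc D k x" "otgt D k (osrc D k x) = osrc D k x"
    "osrc D k (otgt D k x) = otgt D k x" "otgt D k (otgt D k x) = otgt D k x"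
    if "x \<in> carrier D" for k x
    using cat[of k] that unfolding one_set_category_def by blast+
  have two: "one_set_2category (carrier D)
        (ocomp D m) (osrc D m) (otgt D m) (ocomp D k) (osrc D k) (otgt D k)" if "m < k" for m k
    using D that unfolding omega_category_def by blast
  have glob1: "osrc D m (osrc D k x) = osrc D m x" "osrc D m (otgt D k x) = osrc D m x"
    "otgt D m (osrc D k x) = otgt D m x" "otgt D m (otgt D k x) = otgt D m x"
    if "m < k" "x \<in> carrier D" for m k x
    using two[OF that(1)] that(2) unfolding one_set_2category_def by blast+
  have glob2: "osrc D k (osrc D m x) = osrc D m x" "osrc D k (otgt D m x) = otgt D m x"
    "otgt D k (osrc D m x) = osrc D m x" "otgt D k (otgt D m x) = otgt D m x"
    if "m \<le> k" "x \<in> carrier D" for m k x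
  proof -
    have "osrc D k (osrc D m x) = osrc D m x \<and> osrc D k (otgt D m x) = otgt D m x \<and>
      otgt D k (osrc D m x) = osrc D m x \<and> otgt D k (otgt D m x) = otgt D m x"
    proof (cases "m = k")
      case False
      then show ?thesis
        using two[of m k] that unfolding one_set_2category_def by auto
    qed (use idem that in auto)
    then show "osrc D k (osrc D m x) = osrc D m x" "osrc D k (otgt D m x) = otgt D m x"
      "otgt D k (osrc D m x) = osrc D m x" "otgt D k (otgt D m x) = otgt D m x" by auto
  qed
  have dk: "osrc D k d = d" "otgt D k d = d" if "n \<le> k" for k
    using glob2[OF that d(1)] d by simp_all
  let ?C = "free_cell n"
  define h where "h = (\<lambda>x\<in>carrier ?C. if fst x = n then d
    else if snd x then otgt D (fst x) d else osrc D (fst x) d)"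
  have h: "h x = (if fst x = n then d else if snd x then otgt D (fst x) d else osrc D (fst x) d)"
    if "x \<in> carrier ?C" for x
    using that by (simp add: h_def)
  have hmem: "h x \<in> carrier D" if "x \<in> carrier ?C" for x
    using that closed d by (simp add: h)
  have fst_le: "fst x \<le> n" if "x \<in> carrier ?C" for x
    using that by (auto simp: free_cell_def)
  have Cst: "osrc ?C k x \<in> carrier ?C" "otgt ?C k x \<in> carrier ?C" if "x \<in> carrier ?C" for k x
    using that by (auto simp: free_cell_def)
  have hs: "h (osrc ?C k x) = osrc D k (h x)" "h (otgt ?C k x) = otgt D k (h x)"
    if x: "x \<in> carrier ?C" for k x
  proof -
    show "h (osrc ?C k x) = osrc D k (h x)"
    proof (cases "k < fst x")
      case True
      then have "osrc ?C k x = (k, False)" "k < n"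
        using fst_le[OF x] by (auto simp: free_cell_def)
      then show ?thesis using Cst(1)[OF x, of k] True glob1 d by (simp add: h x)
    next
      case False
      then have "osrc ?C k x = x" by (auto simp: free_cell_def)
      then show ?thesis using False glob2 d dk fst_le[OF x] by (simp add: h x)
    qed
    show "h (otgt ?C k x) = otgt D k (h x)"
    proof (cases "k < fst x")
      case True
      then have "otgt ?C k x = (k, True)" "k < n"
        using fst_le[OF x] by (auto simp: free_cell_def)
      then show ?thesis using Cst(2)[OF x, of k] True glob1 d by (simp add: h x)
    next
      case False
      then have "otgt ?C k x = x" by (auto simp: free_cell_def)
      then show ?thesis using False glob2 d dk fst_le[OF x] by (simp add: h x)
    qed
  qed
  have hc: "h (ocomp ?C k x y) = ocomp D k (h x) (h y)"
    if x: "x \<in> carrier ?C" and y: "y \<in> carrier ?C" and xy: "otgt ?C k x = osrc ?C k y" for k x y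
  proof (cases "fst x \<le> k")
    case True
    then have "x = osrc ?C k y" "ocomp ?C k x y = y"
      using xy by (auto simp: free_cell_def)
    then show ?thesis using hs(1)[OF y] unit(1)[OF hmem[OF y]] by simp
  next
    case False
    then have "y = otgt ?C k x" "ocomp ?C k x y = x"
      using xy by (auto simp: free_cell_def split: if_splits)
    then show ?thesis using hs(2)[OF x] unit(2)[OF hmem[OF x]] by simp
  qed
  have top: "(n, True) \<in> carrier ?C" by (simp add: free_cell_def)
  show "h \<in> omega_functors ?C D \<and> h (n, True) = d"
  proof
    have "h \<in> carrier ?C \<rightarrow>\<^sub>E carrier D"
      using hmem by (auto simp: h_def)
    then show "h \<in> omega_functors ?C D"
      unfolding omega_functors_def using hs hc by auto
    show "h (n, True) = d" using h[OF top] by simp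
  qed
  fix f assume f: "f \<in> omega_functors ?C D \<and> f (n, True) = d"
  show "f = h"
  proof (rule extensionalityI)
    show "f \<in> extensional (carrier ?C)" "h \<in> extensional (carrier ?C)"
      using f by (auto simp: omega_functors_def h_def PiE_def)
    fix x assume x: "x \<in> carrier ?C"
    show "f x = h x"
    proof (cases "fst x = n")
      case True
      then have "x = (n, True)" using x by (auto simp: free_cell_def)
      then show ?thesis using f h[OF top] by simp
    next
      case False
      then have lt: "fst x < n" using fst_le[OF x] by simp
      have fs: "f (osrc ?C k (n, True)) = osrc D k d" "f (otgt ?C k (n, True)) = otgt D k d" for k
        using f top unfolding omega_functors_def by auto
      have "x = (if snd x then otgt ?C (fst x) (n, True) else osrc ?C (fst x) (n, True))"
        using lt by (cases x) (auto simp: free_cell_def)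
      then have "f x = (if snd x then otgt D (fst x) d else osrc D (fst x) d)"
        using fs by (metis (full_types))
      then show ?thesis using False h[OF x] by simp
    qed
  qed
qed


section \<open>The simplices as omega-categories\<close>

text \<open>
  A face \<open>(\<sigma>\<^sub>0 \<dots> \<sigma>\<^sub>r)\<close> of the \<open>n\<close>-simplex, being a strictly increasing sequence, is encoded
  by its set of entries. An entry \<open>a\<close> of \<open>x\<close> has position \<open>card {b \<in> x. b < a} + 1\<close>, so the
  odd positions are those for which this cardinality is even.
\<close>

definition faces :: "nat \<Rightarrow> nat set set" where
  "faces n = {x. x \<noteq> {} \<and> x \<subseteq> {..n}}"

definition face_dim :: "nat set \<Rightarrow> nat" where
  "face_dim x = card x - 1"

definition subfaces :: "nat set \<Rightarrow> nat set set" where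
  "subfaces x = {y. y \<noteq> {} \<and> y \<subseteq> x}"

definition Subfaces :: "nat set set \<Rightarrow> nat set set" where
  "Subfaces X = (\<Union>x\<in>X. subfaces x)"

definition src_faces :: "nat set \<Rightarrow> nat set set" where
  "src_faces x = {x - {a} |a. a \<in> x \<and> even (card {b \<in> x. b < a})}"

definition tgt_faces :: "nat set \<Rightarrow> nat set set" where
  "tgt_faces x = {x - {a} |a. a \<in> x \<and> odd (card {b \<in> x. b < a})}"

text \<open>
  \<open>simplex_cell n X s t\<close>: the set \<open>X\<close> is a morphism of \<open>\<Delta>\<^sup>n\<close> and \<open>s\<close>, \<open>t\<close> list its
  sources and targets in all dimensions. The generating rules give
  \<open>s\<^sub>p\<^sub>-\<^sub>1 R(x) = R(s\<^sub>x)\<close>, \<open>t\<^sub>p\<^sub>-\<^sub>1 R(x) = R(t\<^sub>x)\<close> and \<open>X *\<^sub>p Y = X \<union> Y\<close>; the other sources and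
  targets are those dictated by the axioms of an omega-category. For a generator of
  dimension \<open>p\<close> these are \<open>s\<^sub>k R(x) = R(x)\<close> if \<open>k \<ge> p\<close> and \<open>s\<^sub>k R(x) = s\<^sub>k s\<^sub>p\<^sub>-\<^sub>1 R(x)\<close> if
  \<open>k < p - 1\<close>; for a composite they are \<open>s\<^sub>k (X *\<^sub>p Y) = s\<^sub>k X\<close> and
  \<open>t\<^sub>k (X *\<^sub>p Y) = t\<^sub>k Y\<close> if \<open>k \<le> p\<close>, and \<open>s\<^sub>k (X *\<^sub>p Y) = s\<^sub>k X *\<^sub>p s\<^sub>k Y\<close> and likewise for
  \<open>t\<^sub>k\<close> if \<open>k > p\<close>.
\<close>

inductive simplex_cell ::
    "nat \<Rightarrow> nat set set \<Rightarrow> (nat \<Rightarrow> nat set set) \<Rightarrow> (nat \<Rightarrow> nat set set) \<Rightarrow> bool"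
  for n :: nat where
  vertex: "\<lbrakk>x \<in> faces n; face_dim x = 0\<rbrakk> \<Longrightarrow>
     simplex_cell n (subfaces x) (\<lambda>k. subfaces x) (\<lambda>k. subfaces x)"
| face: "\<lbrakk>x \<in> faces n; face_dim x = p; 1 \<le> p;
      simplex_cell n (Subfaces (src_faces x)) s t;
      simplex_cell n (Subfaces (tgt_faces x)) s' t'\<rbrakk> \<Longrightarrow>
     simplex_cell n (subfaces x)
       (\<lambda>k. if p \<le> k then subfaces x else if k = p - 1 then Subfaces (src_faces x) else s k)
       (\<lambda>k. if p \<le> k then subfaces x else if k = p - 1 then Subfaces (tgt_faces x) else t' k)"
| comp: "\<lbrakk>simplex_cell n X s t; simplex_cell n Y s' t'; t p = s' p\<rbrakk> \<Longrightarrow>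
     simplex_cell n (X \<union> Y)
       (\<lambda>k. if k \<le> p then s k else s k \<union> s' k)
       (\<lambda>k. if k \<le> p then t' k else t k \<union> t' k)"

text \<open>
  By the theory of orientals (the simplices are loop-free pasting schemes) a morphism \<open>X\<close>
  has exactly one pair of source and target functions, so the choice below is the only
  possible one.
\<close>

definition simplex_bdry ::
    "nat \<Rightarrow> nat set set \<Rightarrow> (nat \<Rightarrow> nat set set) \<times> (nat \<Rightarrow> nat set set)" where
  "simplex_bdry n X = (SOME st. simplex_cell n X (fst st) (snd st))"

definition simplex :: "nat \<Rightarrow> (nat set set) omega_cat" where
  "simplex n =
     \<lparr>carrier = {X. \<exists>s t. simplex_cell n X s t},
      ocomp = (\<lambda>p X Y. X \<union> Y),
      osrc = (\<lambda>k X. fst (simplex_bdry n X) k),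
      otgt = (\<lambda>k X. snd (simplex_bdry n X) k)\<rparr>"


section \<open>Augmented simplicial sets and their homology\<close>

text \<open>
  The set of \<open>n\<close>-simplices is \<open>simplices X n\<close>, for \<open>n \<ge> -1\<close>; \<open>face_map X n i\<close> and
  \<open>degen_map X n i\<close> are \<open>\<partial>\<^sub>i\<close> and \<open>\<epsilon>\<^sub>i\<close> on \<open>n\<close>-simplices (\<open>0 \<le> i \<le> n\<close>), and
  \<open>augmentation X\<close> is \<open>\<partial>\<^sub>-\<^sub>1\<close>, from the \<open>0\<close>-simplices to the \<open>(-1)\<close>-simplices.
\<close>

record 'x aug_sset =
  simplices :: "int \<Rightarrow> 'x set"
  face_map :: "nat \<Rightarrow> nat \<Rightarrow> 'x \<Rightarrow> 'x"
  degen_map :: "nat \<Rightarrow> nat \<Rightarrow> 'x \<Rightarrow> 'x"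
  augmentation :: "'x \<Rightarrow> 'x"

definition chains :: "'x aug_sset \<Rightarrow> int \<Rightarrow> ('x \<Rightarrow>\<^sub>0 int) monoid" where
  "chains X n = free_Abelian_group (simplices X n)"

definition boundary :: "'x aug_sset \<Rightarrow> int \<Rightarrow> ('x \<Rightarrow>\<^sub>0 int) \<Rightarrow> ('x \<Rightarrow>\<^sub>0 int)" where
  "boundary X n =
     (if 1 \<le> n then
        frag_extend (\<lambda>x. \<Sum>i\<le>nat n. frag_cmul ((-1) ^ i) (frag_of (face_map X (nat n) i x)))
      else if n = 0 then frag_extend (\<lambda>x. frag_of (augmentation X x))
      else (\<lambda>c. 0))"

text \<open>
  For \<open>n \<ge> 1\<close> this is the simplicial homology of the unaugmented simplicial set, for
  \<open>n = 0\<close> it is \<open>ker \<partial>\<^sub>-\<^sub>1 / im (\<partial>\<^sub>0 - \<partial>\<^sub>1)\<close>, and for \<open>n = -1\<close>, where \<open>boundary X (-1) = 0\<close>,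
  it is the cokernel of the augmentation.
\<close>

definition aug_homology :: "'x aug_sset \<Rightarrow> int \<Rightarrow> ('x \<Rightarrow>\<^sub>0 int) set monoid" where
  "aug_homology X n =
     (chains X n)\<lparr>carrier := kernel (chains X n) (chains X (n - 1)) (boundary X n)\<rparr>
     Mod (boundary X (n + 1) ` carrier (chains X (n + 1)))"


section \<open>The globular nerve and globular homology\<close>

definition coface :: "nat \<Rightarrow> nat \<Rightarrow> nat" where
  "coface i k = (if k < i then k else Suc k)"

definition codegen :: "nat \<Rightarrow> nat \<Rightarrow> nat" where
  "codegen i k = (if k \<le> i then k else k - 1)"

text \<open>
  A common type for the \<open>(-1)\<close>-simplices (pairs of objects) and the \<open>n\<close>-simplices
  (functors on \<open>\<Delta>\<^sup>n\<close>) of the globular nerve.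
\<close>

datatype 'a gl_simplex = Endpoints 'a 'a | Simplex "nat set set \<Rightarrow> 'a"

text \<open>
  The prescription \<open>(\<partial>\<^sub>i x)(\<sigma>) = x(\<delta>\<^sub>i \<sigma>)\<close> on faces becomes precomposition with the direct image
  on arbitrary morphisms of the simplex, and similarly for \<open>\<epsilon>\<^sub>i\<close>. On functors
  \<open>augmentation\<close> is \<open>(s\<^sub>0 x, t\<^sub>0 x)\<close>, where a \<open>0\<close>-simplex is identified with its value on the
  only morphism of \<open>\<Delta>\<^sup>0\<close>. The values on \<open>Endpoints\<close> are irrelevant.
\<close>

definition globular_nerve :: "('a, 'b) omega_cat_scheme \<Rightarrow> 'a gl_simplex aug_sset" where
  "globular_nerve C =
     \<lparr>simplices = (\<lambda>n.
        if 0 \<le> n then Simplex ` omega_functors (simplex (nat n)) (path_omega_cat C)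
        else if n = -1 then (\<lambda>(a, b). Endpoints a b) ` (cells_of_dim C 0 \<times> cells_of_dim C 0)
        else {}),
      face_map = (\<lambda>n i \<xi>. case \<xi> of
        Simplex x \<Rightarrow> Simplex (\<lambda>X\<in>carrier (simplex (n - 1)). x ((`) (coface i) ` X))
      | Endpoints a b \<Rightarrow> Endpoints a b),
      degen_map = (\<lambda>n i \<xi>. case \<xi> of
        Simplex x \<Rightarrow> Simplex (\<lambda>X\<in>carrier (simplex (n + 1)). x ((`) (codegen i) ` X))
      | Endpoints a b \<Rightarrow> Endpoints a b),
      augmentation = (\<lambda>\<xi>. case \<xi> of
        Simplex x \<Rightarrow> Endpoints (osrc C 0 (x (subfaces {0}))) (otgt C 0 (x (subfaces {0})))
      | Endpoints a b \<Rightarrow> Endpoints a b)\<rparr>"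

definition globular_homology ::
    "('a, 'b) omega_cat_scheme \<Rightarrow> nat \<Rightarrow> ('a gl_simplex \<Rightarrow>\<^sub>0 int) set monoid" where
  "globular_homology C p = aug_homology (globular_nerve C) (int p - 1)"

end

theory Submission
  imports Defs
begin

text \<open>
  The path category of \<open>2\<^sub>n\<close> is a globe, whose cells in each dimension \<open>d\<close> below the top are a
  source \<open>s\<^sub>d\<close> and a target \<open>t\<^sub>d\<close>. An \<open>\<omega>\<close>-functor from \<open>\<Delta>\<^sup>m\<close> to it is the same as a labelling of the
  faces by cells that is compatible with the generating relations; its value at a morphism \<open>X\<close> is
  the label of highest dimension in \<open>X\<close>. The globe is contracted to \<open>t\<^sub>0\<close> by \<open>s\<^sub>k \<mapsto> t\<^sub>k\<^sub>+\<^sub>1\<close>, and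
  applying this contraction to the labels of the faces that contain a new first vertex extends a
  labelling of \<open>\<Delta>\<^sup>m\<close> to one of \<open>\<Delta>\<^sup>m\<^sup>+\<^sup>1\<close>. This is an extra degeneracy of the augmented globular
  nerve, which therefore is acyclic.

  Going from functors to labellings needs the uniqueness of the sources and targets of a morphism
  of \<open>\<Delta>\<^sup>m\<close>. A labelling is compatible with every choice of them, so it suffices that
  labellings separate faces: each face \<open>\<sigma>\<close> has two labellings that give it the two cells
  of its dimension and agree on all other faces of at most that dimension. They are built by
  induction from cones and suspensions.
\<close>

section \<open>Labellings of faces by the cells of a globe\<close>

text \<open>Removing the first vertex of a face gives a source face, so an edge through a new first
  vertex ends there. This is why the apex of a cone carries the target end \<open>t_0\<close> of the
  globe.

  The obstacle lies in the rules for \<open>simplex_cell\<close>: a generator takes its low sources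
  from its source side and its low targets from its target side, and no rule says that the two sides
  have equal boundaries. The globular identities, and after them uniqueness, are read off from
  labels. Labels detect only the faces of dimension \<open>k\<close> in a \<open>k\<close>-boundary,
  however, which may also have parts of lower dimension; hence the condition
  \<open>skeletal\<close>, by which those parts come from the lower boundaries.

  Separation uses two constructions because the cone leaves \<open>t_k\<close> in dimension
  \<open>k\<close> and so loses information on faces through the new vertex, while the suspension
  collapses the faces that avoid it.

  In degree -1 the augmentation hits at most the pair of \<open>(0, False)\<close> and
  \<open>(0, True)\<close>, so one constant completes the contraction there. This gives exactness in
  degrees from 0 on, that is, for \<open>p > 0\<close>.\<close>

text \<open>
  Cells of the infinite globe are coded as in \<open>free_cell\<close>; the boundary \<open>globe_bd False\<close> is the
  source and \<open>globe_bd True\<close> the target.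
\<close>

definition cell_le :: "nat \<times> bool \<Rightarrow> nat \<times> bool \<Rightarrow> bool" where
  "cell_le c c' \<longleftrightarrow> fst c < fst c' \<or> c = c'"

text \<open>Each cell lies above everything of lower dimension, in particular above its own sources
  and targets, but the two cells of one dimension are incomparable. A set containing both cells of
  its highest dimension has no top.\<close>

definition is_top :: "(nat \<times> bool) set \<Rightarrow> nat \<times> bool \<Rightarrow> bool" where
  "is_top S c \<longleftrightarrow> c \<in> S \<and> (\<forall>c'\<in>S. cell_le c' c)"

definition globe_bd :: "bool \<Rightarrow> nat \<Rightarrow> nat \<times> bool \<Rightarrow> nat \<times> bool" where
  "globe_bd b k c = (if k < fst c then (k, b) else c)"

definition globe_comp :: "nat \<Rightarrow> nat \<times> bool \<Rightarrow> nat \<times> bool \<Rightarrow> nat \<times> bool" where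
  "globe_comp k c d = (if fst c \<le> k then d else c)"

lemma cell_le_refl [simp]: "cell_le c c"
  by (simp add: cell_le_def)

lemma cell_le_trans: "cell_le a b \<Longrightarrow> cell_le b c \<Longrightarrow> cell_le a c"
  by (auto simp: cell_le_def)

lemma cell_le_globe_bd [simp]: "cell_le (globe_bd b k c) c"
  by (auto simp: cell_le_def globe_bd_def)

lemma is_top_unique: "is_top S c \<Longrightarrow> is_top S d \<Longrightarrow> c = d"
  unfolding is_top_def cell_le_def by (metis less_asym)

lemma globe_bd_globe_bd: "j < k \<Longrightarrow> globe_bd b j (globe_bd b' k c) = globe_bd b j c"
  by (auto simp: globe_bd_def)

text \<open>The \<open>p\<close>-source and \<open>p\<close>-target of cells above dimension
  \<open>p\<close> differ, so one of \<open>a\<close>, \<open>b\<close> is itself the common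
  \<open>p\<close>-boundary, and the composite is the other one.\<close>

lemma is_top_Un:
  assumes "is_top A a" "is_top B b" "globe_bd True p a = globe_bd False p b"
  shows "is_top (A \<union> B) (globe_comp p a b)"
proof -
  have "cell_le a (globe_comp p a b)" "cell_le b (globe_comp p a b)"
    using assms(3) by (auto simp: globe_comp_def globe_bd_def cell_le_def split: if_splits)
  then show ?thesis
    using assms(1,2) unfolding is_top_def by (metis Un_iff cell_le_trans globe_comp_def)
qed

lemma globe_bd_comp:
  assumes "globe_bd True p a = globe_bd False p b"
  shows "k \<le> p \<Longrightarrow> globe_bd False k (globe_comp p a b) = globe_bd False k a"
    and "k \<le> p \<Longrightarrow> globe_bd True k (globe_comp p a b) = globe_bd True k b"
    and "p < k \<Longrightarrow> globe_bd e k (globe_comp p a b) =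
           globe_comp p (globe_bd e k a) (globe_bd e k b)"
  using assms by (auto simp: globe_comp_def globe_bd_def split: if_splits)

text \<open>The generating relations for \<open>R(x)\<close> with values of a functor replaced by
  top labels. The bound on the dimension expresses that \<open>R(x)\<close> is its own source in
  dimension \<open>face_dim x\<close>. The condition is local to one face because a functor gives
  labels only at faces of cells that the rules generate.\<close>

definition labelling_at :: "(nat set \<Rightarrow> nat \<times> bool) \<Rightarrow> nat set \<Rightarrow> bool" where
  "labelling_at v x \<longleftrightarrow>
     fst (v x) \<le> face_dim x \<and> (\<forall>y\<in>subfaces x. cell_le (v y) (v x)) \<and>
     (1 \<le> face_dim x \<longrightarrow>
        is_top (v ` Subfaces (src_faces x)) (globe_bd False (face_dim x - 1) (v x)) \<and>
        is_top (v ` Subfaces (tgt_faces x)) (globe_bd True (face_dim x - 1) (v x)))"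

lemma subfaces_self: "x \<noteq> {} \<Longrightarrow> x \<in> subfaces x"
  by (simp add: subfaces_def)

text \<open>
  If \<open>X\<close> and \<open>Y\<close> are \<open>p\<close>-composable, then one of their values has dimension at most \<open>p\<close>, because
  \<open>s\<^sub>p\<close> and \<open>t\<^sub>p\<close> differ; so overlaps of \<open>X\<close> and \<open>Y\<close> do no harm, and no loop-freeness is needed.
\<close>

lemma simplex_cell_labels:
  assumes "simplex_cell n X s t" "\<And>x. x \<in> X \<Longrightarrow> labelling_at v x"
  shows "\<exists>c. is_top (v ` X) c \<and>
    (\<forall>k. is_top (v ` s k) (globe_bd False k c) \<and> is_top (v ` t k) (globe_bd True k c))"
  using assms
proof (induction rule: simplex_cell.induct)
  case (vertex x)
  have x: "x \<noteq> {}" using vertex by (auto simp: faces_def)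
  then have lab: "labelling_at v x" using vertex by (simp add: subfaces_self)
  have "is_top (v ` subfaces x) (v x)"
    using lab x by (auto simp: labelling_at_def is_top_def subfaces_self)
  moreover have "globe_bd b k (v x) = v x" for b k
    using lab vertex by (auto simp: labelling_at_def globe_bd_def)
  ultimately show ?case by (intro exI[of _ "v x"]) auto
next
  case (face x p s t s' t')
  have x: "x \<noteq> {}" using face by (auto simp: faces_def)
  then have lab: "labelling_at v x" using face by (simp add: subfaces_self)
  have top: "is_top (v ` subfaces x) (v x)"
    using lab x by (auto simp: labelling_at_def is_top_def subfaces_self)
  have sub: "Subfaces (src_faces x) \<subseteq> subfaces x" "Subfaces (tgt_faces x) \<subseteq> subfaces x"
    by (auto simp: Subfaces_def subfaces_def src_faces_def tgt_faces_def)
  have st: "is_top (v ` Subfaces (src_faces x)) (globe_bd False (p - 1) (v x))"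
    "is_top (v ` Subfaces (tgt_faces x)) (globe_bd True (p - 1) (v x))"
    using lab face by (auto simp: labelling_at_def)
  from face.IH(1) face.prems sub obtain c where c: "is_top (v ` Subfaces (src_faces x)) c"
    "\<And>k. is_top (v ` s k) (globe_bd False k c)" by blast
  from face.IH(2) face.prems sub obtain c' where c': "is_top (v ` Subfaces (tgt_faces x)) c'"
    "\<And>k. is_top (v ` t' k) (globe_bd True k c')" by blast
  have eq: "c = globe_bd False (p - 1) (v x)" "c' = globe_bd True (p - 1) (v x)"
    using is_top_unique st c(1) c'(1) by blast+
  have high: "globe_bd b k (v x) = v x" if "p \<le> k" for b k
    using lab that face by (auto simp: labelling_at_def globe_bd_def)
  have low: "k < p - 1 \<Longrightarrow> is_top (v ` s k) (globe_bd False k (v x))"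
    "k < p - 1 \<Longrightarrow> is_top (v ` t' k) (globe_bd True k (v x))" for k
    using c(2)[of k] c'(2)[of k] by (simp_all add: eq globe_bd_globe_bd)
  have "is_top (v ` (if p \<le> k then subfaces x else if k = p - 1 then Subfaces (src_faces x) else s k))
      (globe_bd False k (v x))"
    "is_top (v ` (if p \<le> k then subfaces x else if k = p - 1 then Subfaces (tgt_faces x) else t' k))
      (globe_bd True k (v x))" for k
    using low[of k] high[of k] st top by auto
  with top show ?case by blast
next
  case (comp X s t Y s' t' p)
  from comp.IH(1) comp.prems obtain a where a: "is_top (v ` X) a"
    "\<And>k. is_top (v ` s k) (globe_bd False k a)" "\<And>k. is_top (v ` t k) (globe_bd True k a)"
    by blast
  from comp.IH(2) comp.prems obtain b where b: "is_top (v ` Y) b"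
    "\<And>k. is_top (v ` s' k) (globe_bd False k b)" "\<And>k. is_top (v ` t' k) (globe_bd True k b)"
    by blast
  have ab: "globe_bd True p a = globe_bd False p b"
    using is_top_unique a(3)[of p] b(2)[of p] comp.hyps by simp
  \<comment> \<open>Above level \<open>p\<close> the boundaries of the two factors are again
    \<open>p\<close>-composable, so the union lemma applies to them as well.\<close>
  have ab': "globe_bd True p (globe_bd e k a) = globe_bd False p (globe_bd e k b)" if "p < k" for k e
    using ab that by (simp add: globe_bd_globe_bd)
  show ?case
  proof (intro exI conjI allI)
    show "is_top (v ` (X \<union> Y)) (globe_comp p a b)"
      using is_top_Un[OF a(1) b(1) ab] by (simp add: image_Un)
    fix k
    show "is_top (v ` (if k \<le> p then s k else s k \<union> s' k)) (globe_bd False k (globe_comp p a b))"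
      using a(2)[of k] is_top_Un[OF a(2)[of k] b(2)[of k] ab']
      by (auto simp: globe_bd_comp[OF ab] image_Un)
    show "is_top (v ` (if k \<le> p then t' k else t k \<union> t' k)) (globe_bd True k (globe_comp p a b))"
      using b(3)[of k] is_top_Un[OF a(3)[of k] b(3)[of k] ab']
      by (auto simp: globe_bd_comp[OF ab] image_Un)
  qed
qed

section \<open>Faces under increasing maps and under adjoining a first vertex\<close>

lemma card_less_image:
  fixes \<phi> :: "nat \<Rightarrow> nat"
  assumes "strict_mono_on x \<phi>" "a \<in> x"
  shows "card {b \<in> \<phi> ` x. b < \<phi> a} = card {b \<in> x. b < (a::nat)}"
proof -
  have "{b \<in> \<phi> ` x. b < \<phi> a} = \<phi> ` {b \<in> x. b < a}"
    using assms by (auto simp: strict_mono_on_less)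
  then show ?thesis
    using strict_mono_on_imp_inj_on[OF assms(1)] card_image inj_on_subset
    by (metis (no_types, lifting) mem_Collect_eq subsetI)
qed

lemma image_diff_singleton:
  fixes \<phi> :: "nat \<Rightarrow> nat"
  assumes "strict_mono_on x \<phi>" "a \<in> x"
  shows "\<phi> ` (x - {a}) = \<phi> ` x - {\<phi> a}"
  using strict_mono_on_imp_inj_on[OF assms(1)] assms(2) by (auto simp: inj_on_def)

lemma src_faces_alt: "src_faces x = (\<lambda>a. x - {a}) ` {a \<in> x. even (card {b \<in> x. b < a})}"
  by (auto simp: src_faces_def)

lemma tgt_faces_alt: "tgt_faces x = (\<lambda>a. x - {a}) ` {a \<in> x. odd (card {b \<in> x. b < a})}"
  by (auto simp: tgt_faces_def)

lemma faces_image: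
  fixes \<phi> :: "nat \<Rightarrow> nat"
  assumes "strict_mono_on x \<phi>"
  shows "src_faces (\<phi> ` x) = (`) \<phi> ` src_faces x" "tgt_faces (\<phi> ` x) = (`) \<phi> ` tgt_faces x"
proof -
  have "{a \<in> \<phi> ` x. even (card {b \<in> \<phi> ` x. b < a})} = \<phi> ` {a \<in> x. even (card {b \<in> x. b < a})}"
    "{a \<in> \<phi> ` x. odd (card {b \<in> \<phi> ` x. b < a})} = \<phi> ` {a \<in> x. odd (card {b \<in> x. b < a})}"
    using card_less_image[OF assms] by auto
  then show "src_faces (\<phi> ` x) = (`) \<phi> ` src_faces x" "tgt_faces (\<phi> ` x) = (`) \<phi> ` tgt_faces x"
    unfolding src_faces_alt tgt_faces_alt image_image
    using image_diff_singleton[OF assms] by (auto simp: image_iff)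
qed

lemma subfaces_image: "subfaces (\<phi> ` x) = (`) \<phi> ` subfaces x"
  by (auto simp: subfaces_def subset_image_iff)

lemma Subfaces_image: "Subfaces ((`) \<phi> ` X) = (`) \<phi> ` Subfaces X"
  by (auto simp: Subfaces_def subfaces_image)

lemma face_dim_image:
  fixes \<phi> :: "nat \<Rightarrow> nat"
  shows "strict_mono_on x \<phi> \<Longrightarrow> face_dim (\<phi> ` x) = face_dim x"
  by (simp add: face_dim_def card_image strict_mono_on_imp_inj_on)

lemma face_bd_subset:
  "Subfaces (src_faces x) \<subseteq> subfaces x" "Subfaces (tgt_faces x) \<subseteq> subfaces x"
  by (auto simp: Subfaces_def subfaces_def src_faces_def tgt_faces_def)

lemma labelling_at_image:
  fixes \<phi> :: "nat \<Rightarrow> nat"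
  assumes mono: "strict_mono_on x \<phi>" and v: "\<And>y. y \<in> subfaces x \<Longrightarrow> v' (\<phi> ` y) = v y"
    and x: "x \<noteq> {}" and lab: "labelling_at v x"
  shows "labelling_at v' (\<phi> ` x)"
proof -
  have vx: "v' (\<phi> ` x) = v x" using v x by (simp add: subfaces_self)
  have "v' ` (`) \<phi> ` Y = v ` Y" if "Y \<subseteq> subfaces x" for Y
    using that v unfolding image_image by (auto intro!: image_cong)
  note im = this[OF face_bd_subset(1)] this[OF face_bd_subset(2)]
  show ?thesis
    using lab
    unfolding labelling_at_def faces_image[OF mono] Subfaces_image subfaces_image
      face_dim_image[OF mono] im vx
    using v by auto
qed

lemma card_less_insert_0:
  assumes "finite r"
  shows "card {b \<in> insert 0 (Suc ` r). b < Suc a} = Suc (card {b \<in> r. b < a})"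
proof -
  have "{b \<in> insert 0 (Suc ` r). b < Suc a} = insert 0 (Suc ` {b \<in> r. b < a})" by auto
  then show ?thesis using assms by (simp add: card_image)
qed

text \<open>A new first vertex moves all other positions up by one and flips their parity, so
  targets of the base yield sources of the cone and conversely. Removing the new vertex itself gives
  the base as one more source face.\<close>

lemma faces_insert_0:
  assumes "finite r"
  shows "src_faces (insert 0 (Suc ` r)) =
      insert (Suc ` r) ((\<lambda>y. insert 0 (Suc ` y)) ` tgt_faces r)" (is ?S)
    and "tgt_faces (insert 0 (Suc ` r)) = (\<lambda>y. insert 0 (Suc ` y)) ` src_faces r" (is ?T)
proof -
  have 1: "{a \<in> insert 0 (Suc ` r). even (card {b \<in> insert 0 (Suc ` r). b < a})} =
      insert 0 (Suc ` {a \<in> r. odd (card {b \<in> r. b < a})})"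
    using card_less_insert_0[OF assms] by auto
  have 2: "{a \<in> insert 0 (Suc ` r). odd (card {b \<in> insert 0 (Suc ` r). b < a})} =
      Suc ` {a \<in> r. even (card {b \<in> r. b < a})}"
    using card_less_insert_0[OF assms] by auto
  have 3: "insert 0 (Suc ` r) - {Suc a} = insert 0 (Suc ` (r - {a}))" for a by auto
  have 4: "insert 0 (Suc ` r) - {0} = Suc ` r" by auto
  show ?S
    unfolding src_faces_alt[of "insert 0 (Suc ` r)"] tgt_faces_alt[of r] 1 image_insert 4 image_image 3 ..
  show ?T
    unfolding tgt_faces_alt[of "insert 0 (Suc ` r)"] src_faces_alt[of r] 2 image_insert 4 image_image 3 ..
qed

lemma Suc_vimage_simps [simp]:
  "Suc -` Suc ` r = r" "Suc -` insert 0 r = Suc -` r"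
  by auto

lemma nat_set_cases:
  obtains (Suc) r where "x = Suc ` r" | (insert) r where "x = insert 0 (Suc ` r)"
proof -
  have "x = (if 0 \<in> x then insert 0 (Suc ` (Suc -` x)) else Suc ` (Suc -` x))"
  proof (rule Set.set_eqI)
    show "i \<in> x \<longleftrightarrow> i \<in> (if 0 \<in> x then insert 0 (Suc ` (Suc -` x)) else Suc ` (Suc -` x))" for i
      by (cases i) auto
  qed
  then show ?thesis using that by metis
qed

lemma subfaces_insert_0:
  "subfaces (insert 0 (Suc ` r)) =
     (`) Suc ` subfaces r \<union> {{0}} \<union> (\<lambda>y. insert 0 (Suc ` y)) ` subfaces r"
proof (intro equalityI subsetI)
  fix z assume z: "z \<in> subfaces (insert 0 (Suc ` r))"
  show "z \<in> (`) Suc ` subfaces r \<union> {{0}} \<union> (\<lambda>y. insert 0 (Suc ` y)) ` subfaces r"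
  proof (cases z rule: nat_set_cases)
    case (Suc w)
    then have "w \<in> subfaces r" using z by (auto simp: subfaces_def)
    then show ?thesis using Suc by blast
  next
    case (insert w)
    then have "w = {} \<or> w \<in> subfaces r" using z by (auto simp: subfaces_def)
    then show ?thesis using insert by auto
  qed
qed (auto simp: subfaces_def)

lemma Subfaces_insert_0:
  assumes "T \<noteq> {}"
  shows "Subfaces ((\<lambda>y. insert 0 (Suc ` y)) ` T) =
     (`) Suc ` Subfaces T \<union> {{0}} \<union> (\<lambda>y. insert 0 (Suc ` y)) ` Subfaces T"
  using assms by (auto simp: Subfaces_def subfaces_insert_0)

lemma Subfaces_insert: "Subfaces (insert x X) = subfaces x \<union> Subfaces X"
  by (auto simp: Subfaces_def)

lemma Subfaces_empty [simp]: "Subfaces {} = {}" "Subfaces {{}} = {}"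
  by (auto simp: Subfaces_def subfaces_def)

lemma face_dim_insert_0: "finite r \<Longrightarrow> r \<noteq> {} \<Longrightarrow> face_dim (insert 0 (Suc ` r)) = Suc (face_dim r)"
  by (auto simp: face_dim_def card_image card_gt_0_iff)

text \<open>The empty set occurs as a source face of a vertex. It disappears under
  \<open>Subfaces\<close>, but adjoining \<open>0\<close> turns it into the target vertex
  \<open>{0}\<close> of an edge, so that \<open>faces_insert_0\<close> also holds for edges.\<close>

lemma face_dim_0:
  assumes "finite r" "r \<noteq> {}" "face_dim r = 0"
  shows "src_faces r = {{}}" "tgt_faces r = {}"
proof -
  have "card r = 1" using assms card_gt_0_iff[of r] by (simp add: face_dim_def)
  then obtain a where a: "r = {a}" using card_1_singletonE by blast
  have "{b \<in> r. b < c} = {}" if "c \<in> r" for c using that a by auto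
  then have "card {b \<in> r. b < c} = 0" if "c \<in> r" for c using that by (metis card.empty)
  then have "src_faces r = {r - {c} |c. c \<in> r}" "tgt_faces r = {}"
    unfolding src_faces_def tgt_faces_def by (metis (lifting) even_zero, fastforce)
  then show "src_faces r = {{}}" "tgt_faces r = {}"
    using a by auto
qed

lemma src_faces_nonempty:
  assumes "finite r" "r \<noteq> {}"
  shows "src_faces r \<noteq> {}"
proof -
  have "{b \<in> r. b < Min r} = {}" using assms(1) by (auto simp: not_less)
  then have "even (card {b \<in> r. b < Min r})" by (metis card.empty even_zero)
  then show ?thesis
    using Min_in[OF assms] unfolding src_faces_alt by blast
qed

text \<open>The second smallest vertex stands in an even position.\<close>

lemma tgt_faces_nonempty:
  assumes "finite r" "face_dim r \<ge> 1"
  shows "tgt_faces r \<noteq> {}"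
proof -
  have 2: "card r \<ge> 2" using assms(2) by (simp add: face_dim_def)
  then have r: "r \<noteq> {}" by (metis card.empty not_numeral_le_zero)
  define m where "m = Min r"
  have mr: "m \<in> r" unfolding m_def using assms(1) r by (rule Min_in)
  have "card (r - {m}) \<ge> 1" using 2 mr assms(1) by (simp add: card_Diff_singleton)
  then have r2: "r - {m} \<noteq> {}" by (metis card.empty not_one_le_zero)
  define a where "a = Min (r - {m})"
  have ar: "a \<in> r - {m}" unfolding a_def by (rule Min_in) (use assms(1) r2 in auto)
  have "b = m" if "b \<in> r" "b < a" for b
  proof (rule ccontr)
    assume "b \<noteq> m"
    then have "a \<le> b" unfolding a_def using assms(1) that(1) by (intro Min_le) auto
    then show False using that(2) by simp
  qed
  moreover have "m \<le> a" unfolding m_def using assms(1) ar by (intro Min_le) auto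
  then have "m < a" using ar by auto
  ultimately have "{b \<in> r. b < a} = {m}" using mr by blast
  then have "card {b \<in> r. b < a} = 1" by simp
  then have "odd (card {b \<in> r. b < a})" by presburger
  then show ?thesis using ar unfolding tgt_faces_alt by blast
qed

section \<open>Cones, suspensions and separation of faces\<close>

text \<open>
  On chains the cone labels a face with first vertex \<open>0\<close> by \<open>H s\<^sub>k = t\<^sub>k\<^sub>+\<^sub>1\<close> and \<open>H t\<^sub>k = 0\<close>, a
  contraction with \<open>\<partial> H + H \<partial> = -1\<close>: the convention that even positions give the source makes
  \<open>\<partial>\<close> the negative of the usual boundary. A zero chain in the top dimension means that the cell is
  an identity, so \<open>t\<^sub>k\<close> is kept. For the same reason the suspension exchanges sources and targets.
\<close>

definition cone_cell :: "nat \<times> bool \<Rightarrow> nat \<times> bool" where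
  "cone_cell c = (if snd c then c else (Suc (fst c), True))"

definition label_cone :: "(nat set \<Rightarrow> nat \<times> bool) \<Rightarrow> nat set \<Rightarrow> nat \<times> bool" where
  "label_cone v x = (if x = {0} then (0, True) else if 0 \<in> x then cone_cell (v (Suc -` x))
     else v (Suc -` x))"

definition susp_cell :: "nat \<times> bool \<Rightarrow> nat \<times> bool" where
  "susp_cell c = (Suc (fst c), \<not> snd c)"

text \<open>The face opposite to \<open>0\<close> is collapsed to \<open>s_0\<close> and the apex is
  \<open>t_0\<close>. Faces through \<open>0\<close> then carry the given labels one dimension
  higher, without the loss that the cone incurs at \<open>t_k\<close>.\<close>

definition label_susp :: "(nat set \<Rightarrow> nat \<times> bool) \<Rightarrow> nat set \<Rightarrow> nat \<times> bool" where
  "label_susp v x = (if x = {0} then (0, True) else if 0 \<in> x then susp_cell (v (Suc -` x))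
     else (0, False))"

lemma insert_0_eq: "insert 0 (Suc ` r) = {0} \<longleftrightarrow> r = {}"
  by auto

lemma Suc_image_neq_0: "Suc ` r \<noteq> {0}"
  by auto

lemma label_cone_simps [simp]:
  "label_cone v {0} = (0, True)" "label_cone v (Suc ` r) = v r"
  "r \<noteq> {} \<Longrightarrow> label_cone v (insert 0 (Suc ` r)) = cone_cell (v r)"
  by (auto simp: label_cone_def insert_0_eq Suc_image_neq_0)

lemma label_susp_simps [simp]:
  "label_susp v {0} = (0, True)" "label_susp v (Suc ` r) = (0, False)"
  "r \<noteq> {} \<Longrightarrow> label_susp v (insert 0 (Suc ` r)) = susp_cell (v r)"
  by (auto simp: label_susp_def insert_0_eq Suc_image_neq_0)

lemma is_topI: "c \<in> S \<Longrightarrow> (\<And>c'. c' \<in> S \<Longrightarrow> cell_le c' c) \<Longrightarrow> is_top S c"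
  by (auto simp: is_top_def)

lemma is_top_image:
  assumes "is_top S c" "\<And>a b. cell_le a b \<Longrightarrow> cell_le (h a) (h b)"
  shows "is_top (h ` S) (h c)"
  using assms by (auto simp: is_top_def)

lemma is_top_Un_le: "is_top A a \<Longrightarrow> is_top B b \<Longrightarrow> cell_le b a \<Longrightarrow> is_top (A \<union> B) a"
  unfolding is_top_def by (blast intro: cell_le_trans)

lemma is_top_insert_le: "is_top A a \<Longrightarrow> cell_le b a \<Longrightarrow> is_top (insert b A) a"
  unfolding is_top_def by blast

lemma cone_cell_mono: "cell_le a b \<Longrightarrow> cell_le (cone_cell a) (cone_cell b)"
  by (cases a; cases b) (auto simp: cell_le_def cone_cell_def)

lemma susp_cell_mono: "cell_le a b \<Longrightarrow> cell_le (susp_cell a) (susp_cell b)"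
  by (auto simp: cell_le_def susp_cell_def)

lemma is_top_cone_cell: "is_top S c \<Longrightarrow> is_top (cone_cell ` S) (cone_cell c)"
  by (rule is_top_image) (simp_all add: cone_cell_mono)

lemma is_top_susp_cell: "is_top S c \<Longrightarrow> is_top (susp_cell ` S) (susp_cell c)"
  by (rule is_top_image) (simp_all add: susp_cell_mono)

lemma label_cone_image_subfaces_insert:
  "label_cone v ` ((`) Suc ` Y \<union> {{0}} \<union> (\<lambda>y. insert 0 (Suc ` y)) ` Y) =
     insert (0, True) (v ` Y \<union> cone_cell ` v ` Y)" if "{} \<notin> Y"
proof -
  have "label_cone v ` (\<lambda>y. insert 0 (Suc ` y)) ` Y = cone_cell ` v ` Y"
    using that unfolding image_image by (intro image_cong refl) (metis label_cone_simps(3))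
  then show ?thesis by (auto simp: image_Un image_image)
qed

lemma label_susp_image_subfaces_insert:
  "label_susp v ` ((`) Suc ` Y \<union> {{0}} \<union> (\<lambda>y. insert 0 (Suc ` y)) ` Y) =
     insert (0, True) ((\<lambda>_. (0, False)) ` Y \<union> susp_cell ` v ` Y)" if "{} \<notin> Y"
proof -
  have "label_susp v ` (\<lambda>y. insert 0 (Suc ` y)) ` Y = susp_cell ` v ` Y"
    using that unfolding image_image by (intro image_cong refl) (metis label_susp_simps(3))
  then show ?thesis by (auto simp: image_Un image_image)
qed

lemma empty_notin_subfaces [simp]: "{} \<notin> subfaces x" "{} \<notin> Subfaces X"
  by (auto simp: subfaces_def Subfaces_def)

lemma is_top_subfaces: "labelling_at v x \<Longrightarrow> x \<noteq> {} \<Longrightarrow> is_top (v ` subfaces x) (v x)"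
  by (auto simp: labelling_at_def is_top_def subfaces_self)

lemma labelling_at_iff_top:
  assumes "x \<noteq> {}"
  shows "labelling_at v x \<longleftrightarrow> fst (v x) \<le> face_dim x \<and> is_top (v ` subfaces x) (v x) \<and>
     (1 \<le> face_dim x \<longrightarrow>
        is_top (v ` Subfaces (src_faces x)) (globe_bd False (face_dim x - 1) (v x)) \<and>
        is_top (v ` Subfaces (tgt_faces x)) (globe_bd True (face_dim x - 1) (v x)))"
  using assms subfaces_self[OF assms] unfolding labelling_at_def is_top_def by auto

text \<open>The homotopy formula in terms of cells, with \<open>H\<close> for
  \<open>cone_cell\<close>: the target of \<open>H c\<close> is \<open>H\<close> of the source of
  \<open>c\<close> (\<open>eT\<close>), and its source is \<open>c\<close> followed by
  \<open>H\<close> of the target of \<open>c\<close> (\<open>eS\<close>). By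
  \<open>faces_insert_0\<close> these are the two sides of the cone over \<open>r\<close>.\<close>

lemma labelling_at_label_cone_insert:
  assumes fin: "finite r" and r: "r \<noteq> {}" and lab: "labelling_at v r"
  shows "labelling_at (label_cone v) (insert 0 (Suc ` r))"
proof -
  define q where "q = face_dim r"
  obtain d b where c: "v r = (d, b)" by fastforce
  have d: "d \<le> q" using lab c by (simp add: labelling_at_def q_def)
  have top: "is_top (v ` subfaces r) (v r)" using is_top_subfaces lab r by blast
  have whole: "is_top (label_cone v ` subfaces (insert 0 (Suc ` r))) (cone_cell (v r))"
    unfolding subfaces_insert_0 label_cone_image_subfaces_insert[OF empty_notin_subfaces(1)]
    using is_top_Un_le[OF is_top_cone_cell[OF top] top]
    by (intro is_top_insert_le) (auto simp: Un_commute c cell_le_def cone_cell_def)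
  have "is_top (label_cone v ` Subfaces (src_faces (insert 0 (Suc ` r)))) (globe_bd False q (cone_cell (v r))) \<and>
    is_top (label_cone v ` Subfaces (tgt_faces (insert 0 (Suc ` r)))) (globe_bd True q (cone_cell (v r)))"
  proof (cases "q = 0")
    case True
    \<comment> \<open>The cone over a vertex is an edge from that vertex to the apex; it is labelled
      by an identity if the vertex already has the label \<open>t_0\<close>.\<close>
    then have *: "src_faces r = {{}}" "tgt_faces r = {}"
      using face_dim_0 fin r by (simp_all add: q_def)
    have "globe_bd False q (cone_cell (v r)) = v r" "globe_bd True q (cone_cell (v r)) = (0, True)"
      using d True c by (auto simp: globe_bd_def cone_cell_def)
    moreover have "subfaces {0::nat} = {{0}}" by (auto simp: subfaces_def)
    ultimately show ?thesis
      using top unfolding faces_insert_0[OF fin] *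
      by (auto simp: Subfaces_insert subfaces_image image_image is_top_def)
  next
    case False
    then have ne: "src_faces r \<noteq> {}" "tgt_faces r \<noteq> {}"
      using src_faces_nonempty tgt_faces_nonempty fin r by (auto simp: q_def)
    have st: "is_top (v ` Subfaces (src_faces r)) (globe_bd False (q - 1) (v r))"
      "is_top (v ` Subfaces (tgt_faces r)) (globe_bd True (q - 1) (v r))"
      using lab False by (auto simp: labelling_at_def q_def)
    have cc: "cell_le x (cone_cell x)" "cell_le (0, True) (cone_cell x)" for x
      by (cases x; auto simp: cell_le_def cone_cell_def)+
    have up: "is_top (insert (0, True) (A \<union> cone_cell ` A)) (cone_cell a)" if "is_top A a" for A a
      using is_top_Un_le[OF is_top_cone_cell[OF that] that] cc
      by (intro is_top_insert_le) (auto simp: Un_commute)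
    have eT: "cone_cell (globe_bd False (q - 1) (v r)) = globe_bd True q (cone_cell (v r))"
      using d False by (auto simp: c globe_bd_def cone_cell_def)
    have eS: "globe_comp (q - 1) (v r) (cone_cell (globe_bd True (q - 1) (v r))) =
        globe_bd False q (cone_cell (v r))"
      using d False by (auto simp: c globe_bd_def cone_cell_def globe_comp_def)
    \<comment> \<open>The two cells may fail to be composable only if \<open>v r\<close> is a source
      of dimension below \<open>q\<close>. Then \<open>H\<close> of the target of \<open>v r\<close>
      lies above \<open>v r\<close>, and it is the required \<open>q\<close>-source by
      itself.\<close>
    have cmp: "globe_bd True (q - 1) (v r) =
        globe_bd False (q - 1) (cone_cell (globe_bd True (q - 1) (v r))) \<or> \<not> b \<and> d < q"
      using d False by (auto simp: c globe_bd_def cone_cell_def)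
    have S: "is_top (v ` subfaces r \<union> insert (0, True) (v ` Subfaces (tgt_faces r) \<union>
        cone_cell ` v ` Subfaces (tgt_faces r))) (globe_bd False q (cone_cell (v r)))"
    proof (cases "\<not> b \<and> d < q")
      case True
      then have "globe_bd False q (cone_cell (v r)) = cone_cell (globe_bd True (q - 1) (v r))"
        by (auto simp: c globe_bd_def cone_cell_def)
      moreover have "cell_le (v r) (cone_cell (globe_bd True (q - 1) (v r)))"
        using True by (auto simp: c globe_bd_def cone_cell_def cell_le_def)
      ultimately show ?thesis
        using is_top_Un_le[OF up[OF st(2)] top] by (simp add: Un_commute)
    next
      case False
      then show ?thesis using is_top_Un[OF top up[OF st(2)]] cmp eS by metis
    qed
    show ?thesis
      unfolding faces_insert_0[OF fin] Subfaces_insert Subfaces_insert_0[OF ne(1)]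
        Subfaces_insert_0[OF ne(2)] image_Un[of _ "subfaces _"]
        label_cone_image_subfaces_insert[OF empty_notin_subfaces(2)]
      using S up[OF st(1)] eT by (simp add: subfaces_image image_image)
  qed
  moreover have "fst (cone_cell (v r)) \<le> Suc q" using d c by (auto simp: cone_cell_def)
  ultimately show ?thesis
    using whole r by (simp add: labelling_at_iff_top face_dim_insert_0 fin flip: q_def)
qed

text \<open>The exchange of signs in \<open>susp_cell\<close> compensates the exchange of parities
  in \<open>faces_insert_0\<close>. The base contributes only \<open>s_0\<close>, which lies below
  every suspended cell.\<close>

lemma labelling_at_label_susp_insert:
  assumes fin: "finite r" and r: "r \<noteq> {}" and lab: "labelling_at v r"
  shows "labelling_at (label_susp v) (insert 0 (Suc ` r))"
proof -
  define q where "q = face_dim r"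
  have d: "fst (v r) \<le> q" using lab by (simp add: labelling_at_def q_def)
  have top: "is_top (v ` subfaces r) (v r)" using is_top_subfaces lab r by blast
  have up: "is_top (insert (0, True) ((\<lambda>_. (0, False)) ` Y \<union> susp_cell ` v ` Y)) (susp_cell a)"
    if "is_top (v ` Y) a" for Y :: "nat set set" and a
    using is_top_susp_cell[OF that]
    by (auto simp: is_top_def cell_le_def susp_cell_def)
  have whole: "is_top (label_susp v ` subfaces (insert 0 (Suc ` r))) (susp_cell (v r))"
    unfolding subfaces_insert_0 label_susp_image_subfaces_insert[OF empty_notin_subfaces(1)]
    using up[OF top] .
  have const: "label_susp v ` (`) Suc ` subfaces r = {(0, False)}"
    using subfaces_self[OF r] by (auto simp: image_image)
  have "is_top (label_susp v ` Subfaces (src_faces (insert 0 (Suc ` r)))) (globe_bd False q (susp_cell (v r))) \<and>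
    is_top (label_susp v ` Subfaces (tgt_faces (insert 0 (Suc ` r)))) (globe_bd True q (susp_cell (v r)))"
  proof (cases "q = 0")
    case True
    then have *: "src_faces r = {{}}" "tgt_faces r = {}"
      using face_dim_0 fin r by (simp_all add: q_def)
    \<comment> \<open>Over a vertex the suspension is an edge from \<open>s_0\<close> to
      \<open>t_0\<close>: its source is supplied by the base and its target by the apex.\<close>
    have "globe_bd e q (susp_cell (v r)) = (0, e)" for e
      using d True by (auto simp: globe_bd_def susp_cell_def)
    moreover have "subfaces {0::nat} = {{0}}" by (auto simp: subfaces_def)
    ultimately show ?thesis
      unfolding faces_insert_0[OF fin] *
      by (simp add: Subfaces_insert subfaces_image const) (simp add: is_top_def)
  next
    case False
    then have ne: "src_faces r \<noteq> {}" "tgt_faces r \<noteq> {}"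
      using src_faces_nonempty tgt_faces_nonempty fin r by (auto simp: q_def)
    have st: "is_top (v ` Subfaces (src_faces r)) (globe_bd False (q - 1) (v r))"
      "is_top (v ` Subfaces (tgt_faces r)) (globe_bd True (q - 1) (v r))"
      using lab False by (auto simp: labelling_at_def q_def)
    have e: "susp_cell (globe_bd b (q - 1) (v r)) = globe_bd (\<not> b) q (susp_cell (v r))" for b
      using d False by (auto simp: globe_bd_def susp_cell_def)
    have "is_top (insert (0, False) (insert (0, True) ((\<lambda>_. (0, False)) ` Subfaces (tgt_faces r) \<union>
        susp_cell ` v ` Subfaces (tgt_faces r)))) (susp_cell (globe_bd True (q - 1) (v r)))"
      using up[OF st(2)] by (rule is_top_insert_le) (simp add: cell_le_def susp_cell_def)
    then show ?thesis
      unfolding faces_insert_0[OF fin] Subfaces_insert Subfaces_insert_0[OF ne(1)]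
        Subfaces_insert_0[OF ne(2)] image_Un[of _ "(`) _ ` subfaces _"]
        label_susp_image_subfaces_insert[OF empty_notin_subfaces(2)] subfaces_image const
      using up[OF st(1)] by (simp add: e[unfolded One_nat_def] insert_commute)
  qed
  moreover have "fst (susp_cell (v r)) \<le> Suc q" using d by (auto simp: susp_cell_def)
  ultimately show ?thesis
    using whole r by (simp add: labelling_at_iff_top face_dim_insert_0 fin flip: q_def)
qed

lemma labelling_at_singleton: "fst (v {a}) = 0 \<Longrightarrow> labelling_at v {a}"
  by (auto simp: labelling_at_def face_dim_def subfaces_def subset_singleton_iff)

lemma labelling_at_label_cone:
  assumes "finite x" "x \<noteq> {}" "Suc -` x \<noteq> {} \<Longrightarrow> labelling_at v (Suc -` x)"
  shows "labelling_at (label_cone v) x"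
proof (cases x rule: nat_set_cases)
  case (Suc r)
  then show ?thesis
    using assms by (auto intro!: labelling_at_image[of r Suc _ v] strict_mono_onI)
next
  case (insert r)
  have "finite r" using assms(1) insert by (auto dest: finite_imageD)
  then show ?thesis
    using assms insert labelling_at_label_cone_insert[of r v]
    by (cases "r = {}") (auto intro: labelling_at_singleton)
qed

text \<open>An empty set has no top, so the content is that a face of positive dimension has both
  source and target faces, none of them empty.\<close>

lemma labelling_at_const:
  assumes x: "finite x" "x \<noteq> {}"
  shows "labelling_at (\<lambda>_. (0, b)) x"
proof -
  have "Y = {} \<or> Subfaces Y \<noteq> {}" if "{} \<notin> Y" for Y :: "nat set set"
    using that subfaces_self unfolding Subfaces_def by blast
  moreover have "{} \<notin> src_faces x" "{} \<notin> tgt_faces x" if "1 \<le> face_dim x"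
  proof -
    have "x - {a} \<noteq> {}" for a
      using that x card_mono[of "{a}" x] by (auto simp: face_dim_def)
    then show "{} \<notin> src_faces x" "{} \<notin> tgt_faces x"
      unfolding src_faces_alt tgt_faces_alt by blast+
  qed
  ultimately have ne: "Subfaces (src_faces x) \<noteq> {}" "Subfaces (tgt_faces x) \<noteq> {}"
    if "1 \<le> face_dim x"
    using that src_faces_nonempty[OF x] tgt_faces_nonempty[OF x(1) that] by metis+
  have "is_top ((\<lambda>_. (0, b)) ` Y) (0, b)" if "Y \<noteq> {}" for Y :: "nat set set"
    using that by (auto simp: is_top_def)
  then show ?thesis using ne by (simp add: labelling_at_def globe_bd_def)
qed

lemma labelling_at_label_susp:
  assumes "finite x" "x \<noteq> {}" "Suc -` x \<noteq> {} \<Longrightarrow> labelling_at v (Suc -` x)"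
  shows "labelling_at (label_susp v) x"
proof (cases x rule: nat_set_cases)
  case (Suc r)
  then have "finite r" "r \<noteq> {}" using assms(1,2) by (auto dest: finite_imageD)
  then show ?thesis
    unfolding Suc
    by (intro labelling_at_image[of r Suc _ "\<lambda>_. (0, False)"] labelling_at_const)
      (auto intro: strict_mono_onI)
next
  case (insert r)
  have "finite r" using assms(1) insert by (auto dest: finite_imageD)
  then show ?thesis
    using assms insert labelling_at_label_susp_insert[of r v]
    by (cases "r = {}") (auto intro: labelling_at_singleton)
qed

text \<open>Labellings of the simplex on all natural numbers: cones and suspensions shift the
  vertices, and here no bound on them has to be tracked.\<close>

definition labelling :: "(nat set \<Rightarrow> nat \<times> bool) \<Rightarrow> bool" where
  "labelling v \<longleftrightarrow> (\<forall>x. finite x \<longrightarrow> x \<noteq> {} \<longrightarrow> labelling_at v x)"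

lemma labelling_label_cone:
  assumes "labelling v"
  shows "labelling (label_cone v)"
  unfolding labelling_def
proof (intro allI impI labelling_at_label_cone)
  fix x :: "nat set" assume "finite x" "Suc -` x \<noteq> {}"
  then show "labelling_at v (Suc -` x)"
    using assms finite_vimageI[of x Suc] by (simp add: labelling_def)
qed

lemma labelling_label_susp:
  assumes "labelling v"
  shows "labelling (label_susp v)"
  unfolding labelling_def
proof (intro allI impI labelling_at_label_susp)
  fix x :: "nat set" assume "finite x" "Suc -` x \<noteq> {}"
  then show "labelling_at v (Suc -` x)"
    using assms finite_vimageI[of x Suc] by (simp add: labelling_def)
qed

lemma labelling_const: "labelling (\<lambda>_. (0, b))"
  by (simp add: labelling_def labelling_at_const)

text \<open>Induction on the number of available vertices. If \<open>0\<close> is not in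
  \<open>\<sigma>\<close>, cones work: they keep the labels of shifted faces, and a face through
  \<open>0\<close> of dimension at most that of \<open>\<sigma>\<close> has a base of smaller
  dimension than \<open>r\<close>, where \<open>f\<close> and \<open>g\<close> agree. If
  \<open>0\<close> is in \<open>\<sigma>\<close>, suspensions work, since they are constant off
  \<open>0\<close>.\<close>

lemma separating_labellings:
  assumes "\<sigma> \<subseteq> {..<n}" "\<sigma> \<noteq> {}"
  shows "\<exists>f g. labelling f \<and> labelling g \<and> f \<sigma> = (face_dim \<sigma>, True) \<and> g \<sigma> = (face_dim \<sigma>, False) \<and>
    (\<forall>\<tau>. finite \<tau> \<longrightarrow> \<tau> \<noteq> {} \<longrightarrow> \<tau> \<noteq> \<sigma> \<longrightarrow> face_dim \<tau> \<le> face_dim \<sigma> \<longrightarrow> f \<tau> = g \<tau>)"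
  using assms
proof (induction n arbitrary: \<sigma>)
  case (Suc n)
  have shift: "r \<subseteq> {..<n}" if "Suc ` r \<subseteq> \<sigma>" for r
    using that Suc.prems by force
  show ?case
  proof (cases \<sigma> rule: nat_set_cases)
    case (Suc r)
    then have "r \<noteq> {}" "r \<subseteq> {..<n}" using Suc.prems shift by auto
    then obtain f g where fg: "labelling f" "labelling g" "f r = (face_dim r, True)"
      "g r = (face_dim r, False)"
      "\<And>\<tau>. finite \<tau> \<Longrightarrow> \<tau> \<noteq> {} \<Longrightarrow> \<tau> \<noteq> r \<Longrightarrow> face_dim \<tau> \<le> face_dim r \<Longrightarrow> f \<tau> = g \<tau>"
      using Suc.IH[of r] by blast
    have dim: "face_dim (Suc ` y) = face_dim y" for y by (simp add: face_dim_def card_image)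
    have "label_cone f \<tau> = label_cone g \<tau>"
      if "finite \<tau>" "\<tau> \<noteq> {}" "\<tau> \<noteq> \<sigma>" "face_dim \<tau> \<le> face_dim \<sigma>" for \<tau>
    proof (cases \<tau> rule: nat_set_cases)
      case (Suc y)
      have "y \<noteq> r" using that(3) Suc \<open>\<sigma> = Suc ` r\<close> by blast
      have "finite y" "y \<noteq> {}" "face_dim y \<le> face_dim r"
        using that Suc \<open>\<sigma> = Suc ` r\<close> by (simp_all add: dim finite_image_iff)
      then show ?thesis using fg(5)[of y] Suc \<open>y \<noteq> r\<close> by simp
    next
      case (insert y)
      show ?thesis
      proof (cases "y = {}")
        case False
        moreover have "finite y" using that(1) insert by (simp add: finite_image_iff)
        moreover have "face_dim y < face_dim r"
          using that(4) \<open>\<sigma> = Suc ` r\<close> insert face_dim_insert_0[OF \<open>finite y\<close> False] dim[of r] by simp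
        ultimately show ?thesis using fg(5)[of y] insert by (cases "y = r") simp_all
      qed (simp add: insert)
    qed
    moreover have "label_cone f \<sigma> = (face_dim \<sigma>, True)" "label_cone g \<sigma> = (face_dim \<sigma>, False)"
      using fg(3,4) Suc dim[of r] by simp_all
    ultimately show ?thesis using labelling_label_cone[OF fg(1)] labelling_label_cone[OF fg(2)] by blast
  next
    case (insert r)
    show ?thesis
    proof (cases "r = {}")
      case True
      \<comment> \<open>Among the vertices, the constant labelling by \<open>s_0\<close> and its
        suspension differ only at the apex \<open>{0}\<close>.\<close>
      define g where "g = (\<lambda>_::nat set. (0::nat, False))"
      have dim: "face_dim \<sigma> = 0" using insert True by (simp add: face_dim_def)
      have "label_susp g \<tau> = g \<tau>"
        if "finite \<tau>" "\<tau> \<noteq> {}" "\<tau> \<noteq> \<sigma>" "face_dim \<tau> \<le> face_dim \<sigma>" for \<tau>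
      proof (cases \<tau> rule: nat_set_cases)
        case (insert y)
        then have y: "finite y" "y \<noteq> {}"
          using that \<open>\<sigma> = insert 0 (Suc ` r)\<close> True by (auto simp: finite_image_iff)
        then show ?thesis using that(4) dim face_dim_insert_0[OF y] insert by simp
      qed (simp add: g_def)
      moreover have "label_susp g \<sigma> = (face_dim \<sigma>, True)" "g \<sigma> = (face_dim \<sigma>, False)"
        using insert True dim by (simp_all add: g_def)
      moreover have "labelling g" unfolding g_def by (rule labelling_const)
      ultimately show ?thesis using labelling_label_susp[of g] by blast
    next
      case False
      then have r: "r \<noteq> {}" "r \<subseteq> {..<n}" using shift insert by auto
      then have finr: "finite r" using finite_subset by blast
      obtain f g where fg: "labelling f" "labelling g" "f r = (face_dim r, True)"
        "g r = (face_dim r, False)"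
        "\<And>\<tau>. finite \<tau> \<Longrightarrow> \<tau> \<noteq> {} \<Longrightarrow> \<tau> \<noteq> r \<Longrightarrow> face_dim \<tau> \<le> face_dim r \<Longrightarrow> f \<tau> = g \<tau>"
        using Suc.IH[of r] r by blast
      \<comment> \<open>Suspension flips the sign of a cell, so \<open>f\<close> and
        \<open>g\<close> exchange their roles.\<close>
      have "label_susp g \<tau> = label_susp f \<tau>"
        if "finite \<tau>" "\<tau> \<noteq> {}" "\<tau> \<noteq> \<sigma>" "face_dim \<tau> \<le> face_dim \<sigma>" for \<tau>
      proof (cases \<tau> rule: nat_set_cases)
        case (insert y)
        then have "finite y" using that by (auto dest: finite_imageD)
        then show ?thesis
          using that fg(5)[of y] \<open>\<sigma> = insert 0 (Suc ` r)\<close> insert r finr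
          by (cases "y = {}"; cases "y = r") (auto simp: face_dim_insert_0)
      qed auto
      moreover have "label_susp g \<sigma> = (face_dim \<sigma>, True)" "label_susp f \<sigma> = (face_dim \<sigma>, False)"
        using fg(3,4) insert r(1) finr by (simp_all add: susp_cell_def face_dim_insert_0)
      ultimately show ?thesis using labelling_label_susp[OF fg(1)] labelling_label_susp[OF fg(2)] by blast
    qed
  qed
qed auto

section \<open>Uniqueness of sources and targets\<close>

definition top_faces :: "nat \<Rightarrow> nat set set \<Rightarrow> nat set set" where
  "top_faces k S = {x \<in> S. face_dim x = k}"

definition closed_faces :: "nat set set \<Rightarrow> bool" where
  "closed_faces S \<longleftrightarrow> (\<forall>x\<in>S. subfaces x \<subseteq> S)"

lemma closed_faces_Subfaces: "closed_faces (Subfaces X)" "closed_faces (subfaces x)"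
proof -
  have "subfaces z \<subseteq> subfaces y" if "z \<in> subfaces y" for y z
    using that by (auto simp: subfaces_def)
  then show "closed_faces (Subfaces X)" "closed_faces (subfaces x)"
    unfolding closed_faces_def Subfaces_def by blast+
qed

lemma closed_faces_Un: "closed_faces A \<Longrightarrow> closed_faces B \<Longrightarrow> closed_faces (A \<union> B)"
  by (auto simp: closed_faces_def)

lemma Subfaces_subset: "closed_faces S \<Longrightarrow> X \<subseteq> S \<Longrightarrow> Subfaces X \<subseteq> S"
  by (auto simp: closed_faces_def Subfaces_def)

lemma Subfaces_top_subset: "closed_faces S \<Longrightarrow> Subfaces (top_faces k S) \<subseteq> S"
  by (rule Subfaces_subset) (auto simp: top_faces_def)

lemma faces_finite: "x \<in> faces n \<Longrightarrow> finite x" "x \<in> faces n \<Longrightarrow> x \<noteq> {}"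
  by (auto simp: faces_def intro: finite_subset)

lemma labelling_faces: "labelling v \<Longrightarrow> x \<in> faces n \<Longrightarrow> labelling_at v x"
  using faces_finite[of x n] by (simp add: labelling_def)

lemma subfaces_faces: "x \<in> faces n \<Longrightarrow> subfaces x \<subseteq> faces n"
  by (auto simp: subfaces_def faces_def)

lemma face_dim_mono: "finite x \<Longrightarrow> y \<subseteq> x \<Longrightarrow> face_dim y \<le> face_dim x"
  by (auto simp: face_dim_def intro!: diff_le_mono card_mono)

lemma face_dim_remove: "finite x \<Longrightarrow> a \<in> x \<Longrightarrow> face_dim (x - {a}) = face_dim x - 1"
  by (simp add: face_dim_def card_Diff_singleton)

lemma face_bd_dim:
  assumes "finite x"
  shows "y \<in> src_faces x \<Longrightarrow> face_dim y = face_dim x - 1"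
    and "y \<in> tgt_faces x \<Longrightarrow> face_dim y = face_dim x - 1"
  using face_dim_remove[OF assms] by (auto simp: src_faces_def tgt_faces_def)

lemma Subfaces_bd_dim:
  assumes "finite x"
  shows "y \<in> Subfaces (src_faces x) \<Longrightarrow> face_dim y \<le> face_dim x - 1"
    and "y \<in> Subfaces (tgt_faces x) \<Longrightarrow> face_dim y \<le> face_dim x - 1"
proof -
  have *: "face_dim y \<le> face_dim x - 1" if "z \<in> src_faces x \<union> tgt_faces x" "y \<subseteq> z" for z
  proof -
    have "finite z" using that assms by (auto simp: src_faces_def tgt_faces_def)
    then show ?thesis using that face_bd_dim[OF assms, of z] face_dim_mono[of z y] by auto
  qed
  show "y \<in> Subfaces (src_faces x) \<Longrightarrow> face_dim y \<le> face_dim x - 1"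
    "y \<in> Subfaces (tgt_faces x) \<Longrightarrow> face_dim y \<le> face_dim x - 1"
    using * by (auto simp: Subfaces_def subfaces_def)
qed

lemma simplex_cell_shape:
  assumes "simplex_cell n X s t"
  shows "X \<subseteq> faces n \<and> closed_faces X \<and> (\<forall>k. s k \<subseteq> X \<and> t k \<subseteq> X \<and>
    closed_faces (s k) \<and> closed_faces (t k) \<and>
    (\<forall>x\<in>s k. face_dim x \<le> k) \<and> (\<forall>x\<in>t k. face_dim x \<le> k))"
  using assms
proof (induction rule: simplex_cell.induct)
  case (vertex x)
  then have "face_dim y \<le> k" if "y \<in> subfaces x" for y k
    using face_dim_mono[of x y] that faces_finite[of x n] by (auto simp: subfaces_def)
  then show ?case
    using vertex(1) subfaces_faces closed_faces_Subfaces by simp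
next
  case (face x p s t s' t')
  have fin: "finite x" using face faces_finite by blast
  have d: "face_dim y \<le> k" if "y \<in> subfaces x" "p \<le> k" for y k
    using face_dim_mono[of x y] fin that face by (auto simp: subfaces_def)
  note bd = Subfaces_bd_dim[OF fin, unfolded \<open>face_dim x = p\<close>]
  have sub: "s k \<subseteq> subfaces x" "t' k \<subseteq> subfaces x" for k
    using face.IH face_bd_subset[of x] by blast+
  have 1: "(if p \<le> k then subfaces x else if k = p - 1 then Subfaces (src_faces x) else s k) \<subseteq> subfaces x \<and>
      closed_faces (if p \<le> k then subfaces x else if k = p - 1 then Subfaces (src_faces x) else s k) \<and>
      (\<forall>y\<in>if p \<le> k then subfaces x else if k = p - 1 then Subfaces (src_faces x) else s k. face_dim y \<le> k)" for k
    using face.IH(1) sub(1) bd(1) d closed_faces_Subfaces face_bd_subset(1) by simp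
  have 2: "(if p \<le> k then subfaces x else if k = p - 1 then Subfaces (tgt_faces x) else t' k) \<subseteq> subfaces x \<and>
      closed_faces (if p \<le> k then subfaces x else if k = p - 1 then Subfaces (tgt_faces x) else t' k) \<and>
      (\<forall>y\<in>if p \<le> k then subfaces x else if k = p - 1 then Subfaces (tgt_faces x) else t' k. face_dim y \<le> k)" for k
    using face.IH(2) sub(2) bd(2) d closed_faces_Subfaces face_bd_subset(2) by simp
  show ?case
    using 1 2 subfaces_faces[OF face(1)] closed_faces_Subfaces by blast
next
  case (comp X s t Y s' t' p)
  have 1: "(if k \<le> p then s k else s k \<union> s' k) \<subseteq> X \<union> Y \<and>
    closed_faces (if k \<le> p then s k else s k \<union> s' k) \<and>
    (\<forall>y\<in>if k \<le> p then s k else s k \<union> s' k. face_dim y \<le> k)" for k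
    using comp.IH by (simp add: closed_faces_Un) blast
  have 2: "(if k \<le> p then t' k else t k \<union> t' k) \<subseteq> X \<union> Y \<and>
    closed_faces (if k \<le> p then t' k else t k \<union> t' k) \<and>
    (\<forall>y\<in>if k \<le> p then t' k else t k \<union> t' k. face_dim y \<le> k)" for k
    using comp.IH by (simp add: closed_faces_Un) blast
  have "X \<union> Y \<subseteq> faces n" "closed_faces (X \<union> Y)"
    using comp.IH by (simp_all add: closed_faces_Un)
  then show ?case using 1 2 by blast
qed

text \<open>If \<open>f\<close> took the value \<open>t_k\<close> at a face of \<open>S\<close>
  other than \<open>\<sigma>\<close>, then so would \<open>g\<close>, which is incompatible with the
  top \<open>s_k\<close> of \<open>g\<close>. Hence the two distinct tops can only come from
  \<open>\<sigma>\<close>.\<close>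

lemma mem_by_labels:
  assumes S: "S \<subseteq> faces n" "\<And>x. x \<in> S \<Longrightarrow> face_dim x \<le> k"
    and f: "labelling f" "f \<sigma> = (k, True)" and g: "labelling g" "g \<sigma> = (k, False)"
    and fg: "\<And>\<tau>. finite \<tau> \<Longrightarrow> \<tau> \<noteq> {} \<Longrightarrow> \<tau> \<noteq> \<sigma> \<Longrightarrow> face_dim \<tau> \<le> k \<Longrightarrow> f \<tau> = g \<tau>"
    and top: "is_top (f ` S) a" "is_top (g ` S) b"
  shows "\<sigma> \<in> S \<longleftrightarrow> a = (k, True) \<and> b = (k, False)"
proof
  assume \<sigma>: "\<sigma> \<in> S"
  have "fst (v \<tau>) \<le> k" if "labelling v" "\<tau> \<in> S" for v \<tau>
    using that S faces_finite unfolding labelling_def labelling_at_def by (meson le_trans subsetD)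
  then have "fst a \<le> k" "fst b \<le> k" using f(1) g(1) top by (auto simp: is_top_def)
  moreover have "cell_le (k, True) a" "cell_le (k, False) b"
    using top \<sigma> f(2) g(2) unfolding is_top_def by (metis image_eqI)+
  ultimately show "a = (k, True) \<and> b = (k, False)" by (auto simp: cell_le_def)
next
  assume ab: "a = (k, True) \<and> b = (k, False)"
  then obtain \<tau> where \<tau>: "\<tau> \<in> S" "f \<tau> = (k, True)" using top by (auto simp: is_top_def)
  have "\<tau> = \<sigma>"
  proof (rule ccontr)
    assume "\<tau> \<noteq> \<sigma>"
    then have "g \<tau> = (k, True)" using fg \<tau> S faces_finite by (metis subsetD)
    then have "cell_le (k, True) b" using top(2) \<tau>(1) unfolding is_top_def by (metis image_eqI)
    then show False using ab by (simp add: cell_le_def)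
  qed
  then show "\<sigma> \<in> S" using \<tau> by simp
qed

lemma top_faces_eqI:
  assumes S: "S \<subseteq> faces n" "\<And>x. x \<in> S \<Longrightarrow> face_dim x \<le> k"
    and S': "S' \<subseteq> faces n" "\<And>x. x \<in> S' \<Longrightarrow> face_dim x \<le> k"
    and top: "\<And>v. labelling v \<Longrightarrow> \<exists>c. is_top (v ` S) c \<and> is_top (v ` S') c"
  shows "top_faces k S = top_faces k S'"
proof -
  have "\<sigma> \<in> S \<longleftrightarrow> \<sigma> \<in> S'" if \<sigma>: "\<sigma> \<in> faces n" "face_dim \<sigma> = k" for \<sigma>
  proof -
    have "\<sigma> \<subseteq> {..<Suc n}" "\<sigma> \<noteq> {}" using \<sigma> by (auto simp: faces_def)
    then obtain f g where fg: "labelling f" "f \<sigma> = (k, True)" "labelling g" "g \<sigma> = (k, False)"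
      "\<And>\<tau>. finite \<tau> \<Longrightarrow> \<tau> \<noteq> {} \<Longrightarrow> \<tau> \<noteq> \<sigma> \<Longrightarrow> face_dim \<tau> \<le> k \<Longrightarrow> f \<tau> = g \<tau>"
      using separating_labellings[of \<sigma> "Suc n"] \<sigma>(2) by blast
    obtain a b where "is_top (f ` S) a" "is_top (f ` S') a" "is_top (g ` S) b" "is_top (g ` S') b"
      using top[OF fg(1)] top[OF fg(3)] by blast
    then show ?thesis
      using mem_by_labels[OF S fg] mem_by_labels[OF S' fg] by simp
  qed
  then show ?thesis using S(1) S'(1) unfolding top_faces_def by blast
qed

text \<open>A boundary \<open>u k\<close> need not be the closure of its
  \<open>k\<close>-dimensional faces, since a cell of dimension below \<open>k\<close> is its own
  \<open>k\<close>-source. A skeletal sequence is still determined up to level \<open>k\<close> by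
  the \<open>j\<close>-dimensional faces of \<open>u j\<close> for \<open>j \<le> k\<close>, which
  are what labels can detect.\<close>

definition skeletal :: "nat \<Rightarrow> (nat \<Rightarrow> nat set set) \<Rightarrow> bool" where
  "skeletal n u \<longleftrightarrow> (\<forall>k. u k = (\<Union>j\<le>k. Subfaces (top_faces j (u j)))) \<and>
     (\<forall>k. u k \<subseteq> faces n \<and> (\<forall>x\<in>u k. face_dim x \<le> k))"

lemma skeletalD:
  assumes "skeletal n u"
  shows "u k = (\<Union>j\<le>k. Subfaces (top_faces j (u j)))" "u k \<subseteq> faces n" "x \<in> u k \<Longrightarrow> face_dim x \<le> k"
  using assms unfolding skeletal_def by blast+

lemma skeleton_eqI:
  assumes u: "skeletal n u" and u': "skeletal n u'"
    and top: "\<And>v j. labelling v \<Longrightarrow> j \<le> k \<Longrightarrow> \<exists>c. is_top (v ` u j) c \<and> is_top (v ` u' j) c"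
  shows "u k = u' k"
proof -
  have "top_faces j (u j) = top_faces j (u' j)" if "j \<le> k" for j
    using skeletalD(2)[OF u] skeletalD(3)[OF u] skeletalD(2)[OF u'] skeletalD(3)[OF u'] top[OF _ that]
    by (rule top_faces_eqI)
  then have "(\<Union>j\<le>k. Subfaces (top_faces j (u j))) = (\<Union>j\<le>k. Subfaces (top_faces j (u' j)))"
    by (intro SUP_cong) auto
  then show ?thesis unfolding skeletalD(1)[OF u, of k] skeletalD(1)[OF u', of k] .
qed

text \<open>Under any labelling \<open>v\<close> the two sides have as tops the source and the
  target of the single cell \<open>v x\<close>, and these have equal boundaries in lower dimensions.
  Skeletality, available as an induction hypothesis in \<open>simplex_cell_skeleton\<close>, turns
  agreement of tops into equality.\<close>

lemma face_bd_globular: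
  assumes x: "x \<in> faces n" "face_dim x = p" "1 \<le> p"
    and src: "simplex_cell n (Subfaces (src_faces x)) s t" "skeletal n s" "skeletal n t"
    and tgt: "simplex_cell n (Subfaces (tgt_faces x)) s' t'" "skeletal n s'" "skeletal n t'"
    and k: "k < p - 1"
  shows "s k = s' k" "t k = t' k"
proof -
  have top: "\<exists>c. is_top (v ` s j) c \<and> is_top (v ` s' j) c" "\<exists>c. is_top (v ` t j) c \<and> is_top (v ` t' j) c"
    if v: "labelling v" and j: "j \<le> k" for v j
  proof -
    note lab = labelling_faces[OF v]
    have st: "is_top (v ` Subfaces (src_faces x)) (globe_bd False (p - 1) (v x))"
      "is_top (v ` Subfaces (tgt_faces x)) (globe_bd True (p - 1) (v x))"
      using lab[OF x(1)] x(2,3) by (auto simp: labelling_at_def)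
    obtain c where c: "is_top (v ` Subfaces (src_faces x)) c"
      "\<And>k. is_top (v ` s k) (globe_bd False k c)" "\<And>k. is_top (v ` t k) (globe_bd True k c)"
      using simplex_cell_labels[OF src(1), of v] lab simplex_cell_shape[OF src(1)] by blast
    obtain c' where c': "is_top (v ` Subfaces (tgt_faces x)) c'"
      "\<And>k. is_top (v ` s' k) (globe_bd False k c')" "\<And>k. is_top (v ` t' k) (globe_bd True k c')"
      using simplex_cell_labels[OF tgt(1), of v] lab simplex_cell_shape[OF tgt(1)] by blast
    have "c = globe_bd False (p - 1) (v x)" "c' = globe_bd True (p - 1) (v x)"
      using is_top_unique c(1) c'(1) st by blast+
    then have "globe_bd e j c = globe_bd e j c'" for e
      using globe_bd_globe_bd[of j "p - 1"] j k by simp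
    then show "\<exists>c. is_top (v ` s j) c \<and> is_top (v ` s' j) c" "\<exists>c. is_top (v ` t j) c \<and> is_top (v ` t' j) c"
      using c(2,3)[of j] c'(2,3)[of j] by (auto simp del: split_paired_Ex)
  qed
  show "s k = s' k" using src(2) tgt(2) top(1) by (rule skeleton_eqI)
  show "t k = t' k" using src(3) tgt(3) top(2) by (rule skeleton_eqI)
qed

lemma composable_globular:
  assumes X: "simplex_cell n X s t" "skeletal n s" "skeletal n t"
    and Y: "simplex_cell n Y s' t'" "skeletal n s'" "skeletal n t'"
    and XY: "t p = s' p" and k: "k < p"
  shows "s k = s' k" "t k = t' k"
proof -
  have top: "\<exists>c. is_top (v ` s j) c \<and> is_top (v ` s' j) c" "\<exists>c. is_top (v ` t j) c \<and> is_top (v ` t' j) c"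
    if v: "labelling v" and j: "j \<le> k" for v j
  proof -
    note lab = labelling_faces[OF v]
    obtain c where c: "\<And>k. is_top (v ` s k) (globe_bd False k c)"
        "\<And>k. is_top (v ` t k) (globe_bd True k c)"
      using simplex_cell_labels[OF X(1), of v] lab simplex_cell_shape[OF X(1)] by blast
    obtain c' where c': "\<And>k. is_top (v ` s' k) (globe_bd False k c')"
        "\<And>k. is_top (v ` t' k) (globe_bd True k c')"
      using simplex_cell_labels[OF Y(1), of v] lab simplex_cell_shape[OF Y(1)] by blast
    have "globe_bd True p c = globe_bd False p c'"
      using is_top_unique c(2)[of p] c'(1)[of p] XY by simp
    then have "globe_bd e j c = globe_bd e j c'" for e
      using globe_bd_globe_bd[of j p] j k by (metis le_less_trans)
    then show "\<exists>c. is_top (v ` s j) c \<and> is_top (v ` s' j) c" "\<exists>c. is_top (v ` t j) c \<and> is_top (v ` t' j) c"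
      using c(1,2)[of j] c'(1,2)[of j] by (auto simp del: split_paired_Ex)
  qed
  show "s k = s' k" using X(2) Y(2) top(1) by (rule skeleton_eqI)
  show "t k = t' k" using X(3) Y(3) top(2) by (rule skeleton_eqI)
qed

text \<open>The two claims need each other: the globular identities rest on skeletality of the
  parts, the inclusions rest on the globular identities, and skeletality of a composite rests on the
  inclusions.\<close>

lemma simplex_cell_skeleton:
  assumes "simplex_cell n X s t"
  shows "skeletal n s \<and> skeletal n t \<and>
    (\<forall>k l. k < l \<longrightarrow> s k \<subseteq> s l \<and> s k \<subseteq> t l \<and> t k \<subseteq> s l \<and> t k \<subseteq> t l)"
  using assms
proof (induction rule: simplex_cell.induct)
  case (vertex x)
  have "top_faces 0 (subfaces x) \<noteq> {}" "x \<in> top_faces 0 (subfaces x)"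
    using vertex faces_finite[of x n] subfaces_self[of x] by (auto simp: top_faces_def)
  then have "subfaces x \<subseteq> Subfaces (top_faces 0 (subfaces x))" by (auto simp: Subfaces_def)
  then have "subfaces x \<subseteq> (\<Union>j\<le>k. Subfaces (top_faces j (subfaces x)))" for k
    by (rule subset_trans) (rule UN_upper, simp)
  moreover have "Subfaces (top_faces j (subfaces x)) \<subseteq> subfaces x" for j
    by (rule Subfaces_top_subset) (rule closed_faces_Subfaces)
  ultimately have "subfaces x = (\<Union>j\<le>k. Subfaces (top_faces j (subfaces x)))" for k
    by (intro equalityI UN_least)
  then show ?case
    using simplex_cell_shape[OF simplex_cell.vertex[OF vertex]] unfolding skeletal_def by blast
next
  case (face x p s t s' t')
  define S where "S = (\<lambda>k. if p \<le> k then subfaces x else if k = p - 1 then Subfaces (src_faces x) else s k)"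
  define T where "T = (\<lambda>k. if p \<le> k then subfaces x else if k = p - 1 then Subfaces (tgt_faces x) else t' k)"
  have fin: "finite x" "x \<noteq> {}" using face.hyps(1) faces_finite by blast+
  have cell: "simplex_cell n (subfaces x) S T"
    unfolding S_def T_def using face.hyps by (rule simplex_cell.face)
  note shS = simplex_cell_shape[OF face.hyps(4)] and shT = simplex_cell_shape[OF face.hyps(5)]
    and sh = simplex_cell_shape[OF cell]
  have eq: "s k = s' k" "t k = t' k" if "k < p - 1" for k
    using face_bd_globular[OF face.hyps(1,2,3,4) _ _ face.hyps(5) _ _ that] face.IH by simp_all
  \<comment> \<open>The common argument for sources and targets, with \<open>Y\<close> the set of
    source or target faces. From level \<open>p\<close> on, the closure of \<open>x\<close> is
    everything; at level \<open>p - 1\<close>, the faces in \<open>Y\<close> already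
    generate.\<close>
  have low: "U k = (\<Union>j\<le>k. Subfaces (top_faces j (U j)))"
    if U: "\<And>j. U j \<subseteq> subfaces x" "\<And>j. closed_faces (U j)" "\<And>j. p \<le> j \<Longrightarrow> U j = subfaces x"
      "U (p - 1) = Subfaces Y" "\<And>y. y \<in> Y \<Longrightarrow> face_dim y = p - 1" "{} \<notin> Y"
      "\<And>j. j < p - 1 \<Longrightarrow> U j \<subseteq> Subfaces Y"
      "\<And>k. k < p - 1 \<Longrightarrow> U k = (\<Union>j\<le>k. Subfaces (top_faces j (U j)))" for U Y k
  proof -
    have sub: "Subfaces (top_faces j (U j)) \<subseteq> U j" for j
      using U(2) by (rule Subfaces_top_subset)
    consider "p \<le> k" | "k = p - 1" | "k < p - 1" by linarith
    then show ?thesis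
    proof cases
      case 1
      have "x \<in> top_faces p (U p)"
        using U(3)[of p] face.hyps(2) subfaces_self[OF fin(2)] by (simp add: top_faces_def)
      then have "subfaces x \<subseteq> Subfaces (top_faces p (U p))" by (auto simp: Subfaces_def)
      moreover have "Subfaces (top_faces j (U j)) \<subseteq> subfaces x" for j using sub U(1) by blast
      ultimately show ?thesis unfolding U(3)[OF 1] using 1 by blast
    next
      case 2
      have "y \<in> Subfaces Y" if "y \<in> Y" for y
        using that U(6) subfaces_self[of y] by (auto simp: Subfaces_def)
      then have "Y \<subseteq> U (p - 1)" using U(4) by blast
      then have "Y \<subseteq> top_faces (p - 1) (U (p - 1))" using U(5) by (auto simp: top_faces_def)
      then have "U (p - 1) \<subseteq> Subfaces (top_faces (p - 1) (U (p - 1)))"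
        unfolding U(4) Subfaces_def by blast
      moreover have "Subfaces (top_faces j (U j)) \<subseteq> U (p - 1)" if "j \<le> p - 1" for j
        using sub[of j] U(4) U(7)[of j] that by (cases "j = p - 1") auto
      ultimately show ?thesis unfolding 2 by blast
    qed (use U(8) in blast)
  qed
  have dims: "{} \<notin> src_faces x" "{} \<notin> tgt_faces x"
  proof -
    have "x - {a} \<noteq> {}" for a
      using face.hyps(2,3) card_mono[of "{a}" x] by (auto simp: face_dim_def)
    then show "{} \<notin> src_faces x" "{} \<notin> tgt_faces x"
      unfolding src_faces_alt tgt_faces_alt by blast+
  qed
  have S_low: "S k = s k" "T k = t' k" if "k < p - 1" for k
    using that by (auto simp: S_def T_def)
  have Sp: "S (p - 1) = Subfaces (src_faces x)" "T (p - 1) = Subfaces (tgt_faces x)"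
    "p \<le> j \<Longrightarrow> S j = subfaces x" "p \<le> j \<Longrightarrow> T j = subfaces x" for j
    using face.hyps(3) by (auto simp: S_def T_def)
  have UN_low: "k < p - 1 \<Longrightarrow> (\<Union>j\<le>k. Subfaces (top_faces j (S j))) = (\<Union>j\<le>k. Subfaces (top_faces j (s j)))"
    "k < p - 1 \<Longrightarrow> (\<Union>j\<le>k. Subfaces (top_faces j (T j))) = (\<Union>j\<le>k. Subfaces (top_faces j (t' j)))" for k
    by (intro SUP_cong refl; simp add: S_low)+
  have sk: "skeletal n s" "skeletal n t'"
    using face.IH by simp_all
  have A: "S k = (\<Union>j\<le>k. Subfaces (top_faces j (S j)))" for k
  proof (rule low[of S "src_faces x"])
    show "S j \<subseteq> subfaces x" "closed_faces (S j)" for j using sh by blast+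
    show "S j = subfaces x" if "p \<le> j" for j using Sp(3)[OF that] .
    show "S (p - 1) = Subfaces (src_faces x)" using Sp(1) .
    show "face_dim y = p - 1" if "y \<in> src_faces x" for y
      using face_bd_dim(1)[OF fin(1) that] face.hyps(2) by simp
    show "{} \<notin> src_faces x" by (rule dims)
    show "S j \<subseteq> Subfaces (src_faces x)" if "j < p - 1" for j
      using shS S_low(1)[OF that] by simp
    show "S j = (\<Union>i\<le>j. Subfaces (top_faces i (S i)))" if "j < p - 1" for j
      unfolding UN_low(1)[OF that] S_low(1)[OF that] using skeletalD(1)[OF sk(1)] .
  qed
  have B: "T k = (\<Union>j\<le>k. Subfaces (top_faces j (T j)))" for k
  proof (rule low[of T "tgt_faces x"])
    show "T j \<subseteq> subfaces x" "closed_faces (T j)" for j using sh by blast+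
    show "T j = subfaces x" if "p \<le> j" for j using Sp(4)[OF that] .
    show "T (p - 1) = Subfaces (tgt_faces x)" using Sp(2) .
    show "face_dim y = p - 1" if "y \<in> tgt_faces x" for y
      using face_bd_dim(2)[OF fin(1) that] face.hyps(2) by simp
    show "{} \<notin> tgt_faces x" by (rule dims)
    show "T j \<subseteq> Subfaces (tgt_faces x)" if "j < p - 1" for j
      using shT S_low(2)[OF that] by simp
    show "T j = (\<Union>i\<le>j. Subfaces (top_faces i (T i)))" if "j < p - 1" for j
      unfolding UN_low(2)[OF that] S_low(2)[OF that] using skeletalD(1)[OF sk(2)] .
  qed
  have C: "S k \<subseteq> S l \<and> S k \<subseteq> T l \<and> T k \<subseteq> S l \<and> T k \<subseteq> T l" if "k < l" for k l
  proof -
    consider "p \<le> l" | "l = p - 1" "k < p - 1" | "l < p - 1" "k < p - 1" using \<open>k < l\<close> by linarith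
    then show ?thesis
    proof cases
      case 1
      then show ?thesis using sh Sp by simp
    next
      case 2
      have "s k \<subseteq> Subfaces (src_faces x)" "t k \<subseteq> Subfaces (src_faces x)"
        "s' k \<subseteq> Subfaces (tgt_faces x)" "t' k \<subseteq> Subfaces (tgt_faces x)"
        using shS shT by blast+
      then show ?thesis using eq[OF 2(2)] Sp(1,2) S_low[OF 2(2)] 2(1) by simp
    next
      case 3
      then show ?thesis using eq[of k] eq[of l] S_low face.IH that by simp
    qed
  qed
  have "skeletal n S" "skeletal n T"
    using A B sh unfolding skeletal_def by blast+
  then show ?case using C unfolding S_def T_def by blast
next
  case (comp X s t Y s' t' p)
  note sh = simplex_cell_shape[OF comp.hyps(1)] and sh' = simplex_cell_shape[OF comp.hyps(2)]
  have eq: "s k = s' k" "t k = t' k" if "k < p" for k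
    using composable_globular[OF comp.hyps(1) _ _ comp.hyps(2) _ _ comp.hyps(3) that] comp.IH by simp_all
  have sk: "s k = (\<Union>j\<le>k. Subfaces (top_faces j (s j)))" "t k = (\<Union>j\<le>k. Subfaces (top_faces j (t j)))"
    "s' k = (\<Union>j\<le>k. Subfaces (top_faces j (s' j)))" "t' k = (\<Union>j\<le>k. Subfaces (top_faces j (t' j)))" for k
    by (rule skeletalD(1)[of n], use comp.IH in blast)+
  have inc: "s k \<subseteq> s l" "s k \<subseteq> t l" "t k \<subseteq> s l" "t k \<subseteq> t l"
    "s' k \<subseteq> s' l" "s' k \<subseteq> t' l" "t' k \<subseteq> s' l" "t' k \<subseteq> t' l" if "k < l" for k l
    using comp.IH that by simp_all
  define S where "S = (\<lambda>k. if k \<le> p then s k else s k \<union> s' k)"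
  define T where "T = (\<lambda>k. if k \<le> p then t' k else t k \<union> t' k)"
  have cell: "simplex_cell n (X \<union> Y) S T"
    unfolding S_def T_def using comp.hyps by (rule simplex_cell.comp)
  note SH = simplex_cell_shape[OF cell]
  have C: "S k \<subseteq> S l \<and> S k \<subseteq> T l \<and> T k \<subseteq> S l \<and> T k \<subseteq> T l" if "k < l" for k l
  proof -
    consider "k < l" "l \<le> p" | "k \<le> p" "p < l" | "p < k" using \<open>k < l\<close> by linarith
    then show ?thesis
    proof cases
      case 1
      then show ?thesis using inc[of k l] eq[of k] by (simp add: S_def T_def)
    next
      case 2
      then show ?thesis using inc[of k l] by (auto simp: S_def T_def)
    next
      case 3
      then show ?thesis using inc[of k l] that by (auto simp: S_def T_def)
    qed
  qed
  have mono: "Subfaces (top_faces j A) \<subseteq> Subfaces (top_faces j B)" if "A \<subseteq> B" for A B j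
    using that by (auto simp: Subfaces_def top_faces_def)
  have le: "S k \<subseteq> (\<Union>j\<le>k. Subfaces (top_faces j (S j)))"
    "T k \<subseteq> (\<Union>j\<le>k. Subfaces (top_faces j (T j)))" for k
  proof -
    have s: "s k \<subseteq> (\<Union>j\<le>k. Subfaces (top_faces j (S j)))" for k
      unfolding sk(1)[of k] by (intro UN_mono mono subset_refl) (auto simp: S_def)
    have t': "t' k \<subseteq> (\<Union>j\<le>k. Subfaces (top_faces j (T j)))" for k
      unfolding sk(4)[of k] by (intro UN_mono mono subset_refl) (auto simp: T_def)
    \<comment> \<open>Up to level \<open>p\<close> the composite retains only \<open>s\<close>, so
      the low faces of \<open>s'\<close> have to be found elsewhere: they lie in
      \<open>s' p = t p\<close>, hence in \<open>s k\<close>, which is already covered.\<close>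
    have s': "s' k \<subseteq> (\<Union>j\<le>k. Subfaces (top_faces j (S j)))" if k: "p < k" for k
    proof -
      have "Subfaces (top_faces j (s' j)) \<subseteq> (\<Union>j\<le>k. Subfaces (top_faces j (S j)))" if j: "j \<le> k" for j
      proof (cases "j \<le> p")
        case True
        have "Subfaces (top_faces j (s' j)) \<subseteq> s' j" using sh' by (simp add: Subfaces_top_subset)
        also have "\<dots> \<subseteq> s' p" using inc(5)[of j p] True by (cases "j = p") auto
        also have "\<dots> \<subseteq> s k" using inc(3)[of p k] k comp.hyps(3) by simp
        finally show ?thesis using s by blast
      next
        case False
        then have "Subfaces (top_faces j (s' j)) \<subseteq> Subfaces (top_faces j (S j))"
          by (intro mono) (auto simp: S_def)
        then show ?thesis using j by blast
      qed
      then show ?thesis unfolding sk(3)[of k] by blast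
    qed
    have t: "t k \<subseteq> (\<Union>j\<le>k. Subfaces (top_faces j (T j)))" if k: "p < k" for k
    proof -
      have "Subfaces (top_faces j (t j)) \<subseteq> (\<Union>j\<le>k. Subfaces (top_faces j (T j)))" if j: "j \<le> k" for j
      proof (cases "j \<le> p")
        case True
        have "Subfaces (top_faces j (t j)) \<subseteq> t j" using sh by (simp add: Subfaces_top_subset)
        also have "\<dots> \<subseteq> t p" using inc(4)[of j p] True by (cases "j = p") auto
        also have "\<dots> \<subseteq> t' k" using inc(6)[of p k] k comp.hyps(3) by simp
        finally show ?thesis using t' by blast
      next
        case False
        then have "Subfaces (top_faces j (t j)) \<subseteq> Subfaces (top_faces j (T j))"
          by (intro mono) (auto simp: T_def)
        then show ?thesis using j by blast
      qed
      then show ?thesis unfolding sk(2)[of k] by blast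
    qed
    show "S k \<subseteq> (\<Union>j\<le>k. Subfaces (top_faces j (S j)))"
      using s[of k] s'[of k] by (simp add: S_def[THEN fun_cong, of k])
    show "T k \<subseteq> (\<Union>j\<le>k. Subfaces (top_faces j (T j)))"
      using t[of k] t'[of k] by (simp add: T_def[THEN fun_cong, of k])
  qed
  have ge: "(\<Union>j\<le>k. Subfaces (top_faces j (S j))) \<subseteq> S k"
    "(\<Union>j\<le>k. Subfaces (top_faces j (T j))) \<subseteq> T k" for k
  proof -
    have "Subfaces (top_faces j (S j)) \<subseteq> S k \<and> Subfaces (top_faces j (T j)) \<subseteq> T k" if "j \<le> k" for j
    proof -
      have "Subfaces (top_faces j (S j)) \<subseteq> S j \<and> Subfaces (top_faces j (T j)) \<subseteq> T j"
        using SH by (simp add: Subfaces_top_subset)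
      then show ?thesis using C[of j k] that by (cases "j = k") auto
    qed
    then show "(\<Union>j\<le>k. Subfaces (top_faces j (S j))) \<subseteq> S k"
      "(\<Union>j\<le>k. Subfaces (top_faces j (T j))) \<subseteq> T k" by blast+
  qed
  have "S k = (\<Union>j\<le>k. Subfaces (top_faces j (S j)))" "T k = (\<Union>j\<le>k. Subfaces (top_faces j (T j)))" for k
    using le ge by blast+
  then have "skeletal n S" "skeletal n T"
    using SH unfolding skeletal_def by blast+
  then show ?case using C unfolding S_def T_def by blast
qed

text \<open>Under each labelling the top label of \<open>X\<close> depends on the set
  \<open>X\<close> alone, and it determines the tops of all sources and targets in either
  derivation.\<close>

lemma simplex_cell_unique:
  assumes "simplex_cell n X s t" "simplex_cell n X s' t'"
  shows "s = s'" "t = t'"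
proof -
  note sh = simplex_cell_shape[OF assms(1)] and sh' = simplex_cell_shape[OF assms(2)]
  note sk = simplex_cell_skeleton[OF assms(1)] and sk' = simplex_cell_skeleton[OF assms(2)]
  have top: "\<exists>c. is_top (v ` s j) c \<and> is_top (v ` s' j) c" "\<exists>c. is_top (v ` t j) c \<and> is_top (v ` t' j) c"
    if v: "labelling v" for v j
  proof -
    have lab: "labelling_at v y" if "y \<in> X" for y
      using labelling_faces[OF v] that sh by blast
    obtain c where c: "is_top (v ` X) c" "\<And>k. is_top (v ` s k) (globe_bd False k c)"
        "\<And>k. is_top (v ` t k) (globe_bd True k c)"
      using simplex_cell_labels[OF assms(1), of v] lab by blast
    obtain c' where c': "is_top (v ` X) c'" "\<And>k. is_top (v ` s' k) (globe_bd False k c')"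
        "\<And>k. is_top (v ` t' k) (globe_bd True k c')"
      using simplex_cell_labels[OF assms(2), of v] lab by blast
    have "c = c'" using is_top_unique[OF c(1) c'(1)] .
    then show "\<exists>c. is_top (v ` s j) c \<and> is_top (v ` s' j) c" "\<exists>c. is_top (v ` t j) c \<and> is_top (v ` t' j) c"
      using c(2,3)[of j] c'(2,3)[of j] by blast+
  qed
  have "s k = s' k" for k
    using sk sk' top(1) by (intro skeleton_eqI[of n s s' k]) simp_all
  moreover have "t k = t' k" for k
    using sk sk' top(2) by (intro skeleton_eqI[of n t t' k]) simp_all
  ultimately show "s = s'" "t = t'" by auto
qed

section \<open>Sources and targets as cells of the simplex\<close>

lemma simplex_cell_stable:
  assumes "simplex_cell n X s t" "\<forall>x\<in>X. face_dim x \<le> k"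
  shows "s k = X \<and> t k = X"
  using assms
proof (induction arbitrary: k rule: simplex_cell.induct)
  case (face x p s t s' t')
  have "x \<in> subfaces x" using face.hyps(1) by (intro subfaces_self faces_finite(2))
  then have "p \<le> k" using face.prems face.hyps(2) by blast
  then show ?case by simp
next
  case (comp X s t Y s' t' p)
  have dim: "\<forall>x\<in>X. face_dim x \<le> j" "\<forall>x\<in>Y. face_dim x \<le> j" if "k \<le> j" for j
    using comp.prems that by (blast intro: le_trans)+
  have "s k = X" "t k = X" "s' k = Y" "t' k = Y"
    using comp.IH dim by blast+
  \<comment> \<open>Two factors of dimension at most \<open>p\<close> both coincide with their
    common \<open>p\<close>-boundary.\<close>
  moreover have "X = Y" if "k \<le> p"
    using comp.IH(1)[OF dim(1)[OF that]] comp.IH(2)[OF dim(2)[OF that]] comp.hyps(3) by simp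
  ultimately show ?case by auto
qed simp

text \<open>This is what makes \<open>osrc\<close> and \<open>otgt\<close> stay in the carrier,
  where an extensional functor has meaningful values. The boundary functions are part of the
  statement because, above level \<open>p\<close>, the truncated factors of a composite must again
  be composed along \<open>p\<close>.\<close>

lemma simplex_cell_truncate:
  assumes "simplex_cell n X s t"
  shows "simplex_cell n (s k) (\<lambda>j. if j < k then s j else s k) (\<lambda>j. if j < k then t j else s k) \<and>
    simplex_cell n (t k) (\<lambda>j. if j < k then s j else t k) (\<lambda>j. if j < k then t j else t k)"
  using assms
proof (induction arbitrary: k rule: simplex_cell.induct)
  case (vertex x)
  then show ?case using simplex_cell.vertex[OF vertex] by simp
next
  case (face x p s t s' t')
  define S where "S = (\<lambda>k. if p \<le> k then subfaces x else if k = p - 1 then Subfaces (src_faces x) else s k)"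
  define T where "T = (\<lambda>k. if p \<le> k then subfaces x else if k = p - 1 then Subfaces (tgt_faces x) else t' k)"
  have cell: "simplex_cell n (subfaces x) S T"
    unfolding S_def T_def using face.hyps by (rule simplex_cell.face)
  note sk = simplex_cell_skeleton[OF face.hyps(4)] simplex_cell_skeleton[OF face.hyps(5)]
  have eq: "s j = s' j" "t j = t' j" if "j < p - 1" for j
    using face_bd_globular[OF face.hyps(1,2,3,4) _ _ face.hyps(5) _ _ that] sk by simp_all
  have fin: "finite x" using face.hyps(1) faces_finite by blast
  have stable: "s j = Subfaces (src_faces x)" "t j = Subfaces (src_faces x)"
    "s' j = Subfaces (tgt_faces x)" "t' j = Subfaces (tgt_faces x)" if "p - 1 \<le> j" for j
  proof -
    have "\<forall>y\<in>Subfaces (src_faces x). face_dim y \<le> j" "\<forall>y\<in>Subfaces (tgt_faces x). face_dim y \<le> j"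
      using Subfaces_bd_dim[OF fin] face.hyps(2) that by (metis le_trans)+
    then show "s j = Subfaces (src_faces x)" "t j = Subfaces (src_faces x)"
      "s' j = Subfaces (tgt_faces x)" "t' j = Subfaces (tgt_faces x)"
      using simplex_cell_stable[OF face.hyps(4)] simplex_cell_stable[OF face.hyps(5)] by blast+
  qed
  consider "p \<le> k" | "k = p - 1" | "k < p - 1" by linarith
  then have "simplex_cell n (S k) (\<lambda>j. if j < k then S j else S k) (\<lambda>j. if j < k then T j else S k) \<and>
    simplex_cell n (T k) (\<lambda>j. if j < k then S j else T k) (\<lambda>j. if j < k then T j else T k)"
  proof cases
    case 1
    then have "(\<lambda>j. if j < k then S j else subfaces x) = S" "(\<lambda>j. if j < k then T j else subfaces x) = T"
      by (auto simp: S_def T_def fun_eq_iff)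
    moreover have "S k = subfaces x" "T k = subfaces x" using 1 by (auto simp: S_def T_def)
    ultimately show ?thesis using cell by (simp only: simp_thms)
  next
    case 2
    have Sk: "S k = Subfaces (src_faces x)" "T k = Subfaces (tgt_faces x)"
      using 2 face.hyps(3) by (auto simp: S_def T_def)
    \<comment> \<open>The truncations are exactly the boundary functions of the two premises: below
      \<open>p - 1\<close> by the globular identities, and from \<open>p - 1\<close> on because both
      sides have dimension at most \<open>p - 1\<close>.\<close>
    have "(\<lambda>j. if j < k then S j else S k) = s" "(\<lambda>j. if j < k then T j else S k) = t"
      "(\<lambda>j. if j < k then S j else T k) = s'" "(\<lambda>j. if j < k then T j else T k) = t'"
      unfolding Sk using 2 eq stable by (auto simp: S_def T_def fun_eq_iff)
    then show ?thesis using face.hyps(4,5) by (simp add: Sk)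
  next
    case 3
    have "(\<lambda>j. if j < k then S j else S k) = (\<lambda>j. if j < k then s j else s k)"
      "(\<lambda>j. if j < k then T j else S k) = (\<lambda>j. if j < k then t j else s k)"
      "(\<lambda>j. if j < k then S j else T k) = (\<lambda>j. if j < k then s' j else t' k)"
      "(\<lambda>j. if j < k then T j else T k) = (\<lambda>j. if j < k then t' j else t' k)"
      "S k = s k" "T k = t' k"
      using 3 eq by (auto simp: S_def T_def fun_eq_iff)
    then show ?thesis using face.IH(1)[of k] face.IH(2)[of k] by simp
  qed
  then show ?case unfolding S_def T_def .
next
  case (comp X s t Y s' t' p)
  define S where "S = (\<lambda>k. if k \<le> p then s k else s k \<union> s' k)"
  define T where "T = (\<lambda>k. if k \<le> p then t' k else t k \<union> t' k)"
  note sk = simplex_cell_skeleton[OF comp.hyps(1)] simplex_cell_skeleton[OF comp.hyps(2)]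
  have eq: "s j = s' j" "t j = t' j" if "j < p" for j
    using composable_globular[OF comp.hyps(1) _ _ comp.hyps(2) _ _ comp.hyps(3) that] sk by simp_all
  have "simplex_cell n (S k) (\<lambda>j. if j < k then S j else S k) (\<lambda>j. if j < k then T j else S k) \<and>
    simplex_cell n (T k) (\<lambda>j. if j < k then S j else T k) (\<lambda>j. if j < k then T j else T k)"
  proof (cases "k \<le> p")
    case True
    then have "(\<lambda>j. if j < k then S j else S k) = (\<lambda>j. if j < k then s j else s k)"
      "(\<lambda>j. if j < k then T j else S k) = (\<lambda>j. if j < k then t j else s k)"
      "(\<lambda>j. if j < k then S j else T k) = (\<lambda>j. if j < k then s' j else t' k)"
      "(\<lambda>j. if j < k then T j else T k) = (\<lambda>j. if j < k then t' j else t' k)"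
      "S k = s k" "T k = t' k"
      using eq by (auto simp: S_def T_def fun_eq_iff)
    then show ?thesis using comp.IH(1)[of k] comp.IH(2)[of k] by simp
  next
    case False
    have trunc: "simplex_cell n (u \<union> u') (\<lambda>j. if j < k then S j else u \<union> u') (\<lambda>j. if j < k then T j else u \<union> u')"
      if "simplex_cell n u (\<lambda>j. if j < k then s j else u) (\<lambda>j. if j < k then t j else u)"
        "simplex_cell n u' (\<lambda>j. if j < k then s' j else u') (\<lambda>j. if j < k then t' j else u')" for u u'
    proof -
      have "(\<lambda>j. if j \<le> p then if j < k then s j else u
            else (if j < k then s j else u) \<union> (if j < k then s' j else u')) =
          (\<lambda>j. if j < k then S j else u \<union> u')"
        "(\<lambda>j. if j \<le> p then if j < k then t' j else u'
            else (if j < k then t j else u) \<union> (if j < k then t' j else u')) =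
          (\<lambda>j. if j < k then T j else u \<union> u')"
        using False by (auto simp: S_def T_def fun_eq_iff)
      then show ?thesis using simplex_cell.comp[OF that, of p] False comp.hyps(3) by simp
    qed
    have ST: "S k = s k \<union> s' k" "T k = t k \<union> t' k" using False by (auto simp: S_def T_def)
    show ?thesis unfolding ST using trunc comp.IH(1)[of k] comp.IH(2)[of k] by blast
  qed
  then show ?case unfolding S_def T_def .
qed

lemma carrier_simplex: "X \<in> carrier (simplex n) \<longleftrightarrow> (\<exists>s t. simplex_cell n X s t)"
  by (simp add: simplex_def)

lemma simplex_src_tgt:
  assumes "simplex_cell n X s t"
  shows "osrc (simplex n) k X = s k" "otgt (simplex n) k X = t k"
proof -
  have "\<exists>st. simplex_cell n X (fst st) (snd st)" using assms by auto
  then have "simplex_cell n X (fst (simplex_bdry n X)) (snd (simplex_bdry n X))"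
    unfolding simplex_bdry_def by (rule someI_ex)
  from simplex_cell_unique[OF this assms]
  show "osrc (simplex n) k X = s k" "otgt (simplex n) k X = t k"
    by (simp_all add: simplex_def)
qed

lemma simplex_cell_bd:
  assumes "simplex_cell n X s t"
  shows "s k \<in> carrier (simplex n)" "t k \<in> carrier (simplex n)"
  using simplex_cell_truncate[OF assms, of k] by (auto simp: carrier_simplex)

text \<open>A generator enters a cell only after its source and target sides have been built. A
  proper subface of a generator lies in one of these sides, so every face of a cell spans a cell
  with the prescribed boundary.\<close>

lemma simplex_cell_face:
  assumes "simplex_cell n X s t" "x \<in> X"
  shows "x \<in> faces n \<and> (\<exists>s t. simplex_cell n (subfaces x) s t \<and>
    (\<forall>k\<ge>face_dim x. s k = subfaces x \<and> t k = subfaces x) \<and>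
    (1 \<le> face_dim x \<longrightarrow> s (face_dim x - 1) = Subfaces (src_faces x) \<and>
      t (face_dim x - 1) = Subfaces (tgt_faces x)))"
  using assms
proof (induction rule: simplex_cell.induct)
  case (vertex y)
  have "finite y" using vertex(1) faces_finite by blast
  moreover have "y \<noteq> {}" using vertex(1) faces_finite by blast
  ultimately have "card y = 1" using vertex(2) card_gt_0_iff[of y] by (simp add: face_dim_def)
  then have "x = y" using vertex(3) by (auto simp: subfaces_def card_1_singleton_iff subset_singleton_iff)
  then show ?case using simplex_cell.vertex[OF vertex(1,2)] vertex(1,2) by auto
next
  case (face y p s t s' t')
  show ?case
  proof (cases "x = y")
    case True
    define S where "S = (\<lambda>k. if p \<le> k then subfaces y else if k = p - 1 then Subfaces (src_faces y) else s k)"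
    define T where "T = (\<lambda>k. if p \<le> k then subfaces y else if k = p - 1 then Subfaces (tgt_faces y) else t' k)"
    have "simplex_cell n (subfaces y) S T"
      unfolding S_def T_def using face.hyps by (rule simplex_cell.face)
    moreover have "S k = subfaces y" "T k = subfaces y" if "p \<le> k" for k
      using that by (simp_all add: S_def T_def)
    moreover have "S (p - 1) = Subfaces (src_faces y)" "T (p - 1) = Subfaces (tgt_faces y)"
      using face.hyps(3) by (auto simp: S_def T_def)
    ultimately show ?thesis
      using face.hyps(1,2) unfolding True by blast
  next
    case False
    obtain a where "a \<in> y" "x \<subseteq> y - {a}" "x \<noteq> {}"
      using False face.prems by (auto simp: subfaces_def)
    then have "x \<in> Subfaces (src_faces y) \<or> x \<in> Subfaces (tgt_faces y)"
      unfolding Subfaces_def subfaces_def src_faces_def tgt_faces_def by blast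
    then show ?thesis using face.IH by blast
  qed
next
  case (comp X s t Y s' t' p)
  then show ?case by blast
qed

section \<open>Functors and labellings\<close>

text \<open>The rules yield \<open>R(x)\<close> only once both sides of \<open>x\<close> have been
  obtained as iterated composites. Labels of functors are therefore considered only at faces that
  occur in some cell.\<close>

definition faces_of_cells :: "nat \<Rightarrow> nat set set" where
  "faces_of_cells n = \<Union> (carrier (simplex n))"

lemma faces_of_cellsI: "X \<in> carrier (simplex n) \<Longrightarrow> x \<in> X \<Longrightarrow> x \<in> faces_of_cells n"
  by (auto simp: faces_of_cells_def)

lemma faces_of_cellsD:
  assumes "x \<in> faces_of_cells n"
  obtains s t where "x \<in> faces n" "simplex_cell n (subfaces x) s t"
    "\<And>k. face_dim x \<le> k \<Longrightarrow> s k = subfaces x" "\<And>k. face_dim x \<le> k \<Longrightarrow> t k = subfaces x"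
    "1 \<le> face_dim x \<Longrightarrow> s (face_dim x - 1) = Subfaces (src_faces x)"
    "1 \<le> face_dim x \<Longrightarrow> t (face_dim x - 1) = Subfaces (tgt_faces x)"
proof -
  obtain X s t where "simplex_cell n X s t" "x \<in> X"
    using assms by (auto simp: faces_of_cells_def carrier_simplex)
  from simplex_cell_face[OF this] show ?thesis using that by blast
qed

lemma faces_of_cells_simps:
  assumes "x \<in> faces_of_cells n"
  shows "x \<in> faces n" "subfaces x \<in> carrier (simplex n)"
  by (rule faces_of_cellsD[OF assms], auto simp: carrier_simplex)+

lemma simplex_cell_nonempty: "simplex_cell n X s t \<Longrightarrow> X \<noteq> {}"
proof (induction rule: simplex_cell.induct)
  case (vertex x)
  then show ?case using subfaces_self[OF faces_finite(2)] by blast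
next
  case (face x p s t s' t')
  then show ?case using subfaces_self[OF faces_finite(2)[OF face.hyps(1)]] by blast
qed simp

text \<open>Monotonicity is asked only on \<open>A\<close> because the map is to be a coface or the
  downward shift \<open>i - 1\<close>, and the latter is strictly increasing only away from
  \<open>0\<close>.\<close>

lemma simplex_cell_image:
  assumes "simplex_cell n X s t"
    and "strict_mono_on A \<phi>" "\<phi> ` A \<subseteq> {..m}" "\<And>x. x \<in> X \<Longrightarrow> x \<subseteq> A"
  shows "simplex_cell m ((`) \<phi> ` X) (\<lambda>k. (`) \<phi> ` s k) (\<lambda>k. (`) \<phi> ` t k)"
  using assms(1,4)
proof (induction rule: simplex_cell.induct)
  case (vertex x)
  have x: "x \<noteq> {}" "x \<subseteq> A"
    using vertex subfaces_self[of x] faces_finite(2)[of x n] by auto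
  have mono: "strict_mono_on x \<phi>" using assms(2) x(2) by (rule monotone_on_subset)
  have "\<phi> ` x \<in> faces m" using x assms(3) by (auto simp: faces_def)
  then show ?case
    using simplex_cell.vertex[of "\<phi> ` x" m] face_dim_image[OF mono] vertex(2)
    by (simp add: subfaces_image)
next
  case (face x p s t s' t')
  have x: "x \<noteq> {}" "x \<subseteq> A"
    using face.prems subfaces_self[of x] faces_finite(2)[OF face.hyps(1)] by auto
  have mono: "strict_mono_on x \<phi>" using assms(2) x(2) by (rule monotone_on_subset)
  have fx: "\<phi> ` x \<in> faces m" using x assms(3) by (auto simp: faces_def)
  have dim: "face_dim (\<phi> ` x) = p" using face_dim_image[OF mono] face.hyps(2) by simp
  have "simplex_cell m (Subfaces (src_faces (\<phi> ` x))) (\<lambda>k. (`) \<phi> ` s k) (\<lambda>k. (`) \<phi> ` t k)"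
    "simplex_cell m (Subfaces (tgt_faces (\<phi> ` x))) (\<lambda>k. (`) \<phi> ` s' k) (\<lambda>k. (`) \<phi> ` t' k)"
    unfolding faces_image[OF mono] Subfaces_image
    using face.IH face.prems face_bd_subset[of x] by blast+
  from simplex_cell.face[OF fx dim face.hyps(3) this]
  show ?case
    unfolding faces_image[OF mono] Subfaces_image subfaces_image
    by (simp only: if_distrib[of "(`) ((`) \<phi>)"])
next
  case (comp X s t Y s' t' p)
  have "simplex_cell m ((`) \<phi> ` X) (\<lambda>k. (`) \<phi> ` s k) (\<lambda>k. (`) \<phi> ` t k)"
    "simplex_cell m ((`) \<phi> ` Y) (\<lambda>k. (`) \<phi> ` s' k) (\<lambda>k. (`) \<phi> ` t' k)"
    using comp.IH comp.prems by blast+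
  from simplex_cell.comp[OF this, of p] comp.hyps(3)
  show ?case
    by (simp only: if_distrib[of "(`) ((`) \<phi>)"] image_Un)
qed

text \<open>The path category shifts dimensions by one: its \<open>d\<close>-cells are cells of dimension \<open>Suc d\<close>.\<close>

definition cell_up :: "nat \<times> bool \<Rightarrow> nat \<times> bool" where
  "cell_up c = (Suc (fst c), snd c)"

definition cell_down :: "nat \<times> bool \<Rightarrow> nat \<times> bool" where
  "cell_down c = (fst c - 1, snd c)"

abbreviation path_cell :: "nat \<Rightarrow> (nat \<times> bool) omega_cat" where
  "path_cell n \<equiv> path_omega_cat (free_cell n)"

lemma cell_down_up [simp]: "cell_down (cell_up c) = c"
  by (simp add: cell_down_def cell_up_def)

lemma carrier_path_cell: "x \<in> carrier (path_cell n) \<longleftrightarrow> 0 < fst x \<and> (fst x < n \<or> x = (n, True))"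
  unfolding path_omega_cat_def odim_free_cell by (cases x) (auto simp: free_cell_def)

lemma cell_up_down: "x \<in> carrier (path_cell n) \<Longrightarrow> cell_up (cell_down x) = x"
  by (cases x) (auto simp: carrier_path_cell cell_down_def cell_up_def)

lemma path_cell_ops:
  "osrc (path_cell n) k (cell_up c) = cell_up (globe_bd False k c)"
  "otgt (path_cell n) k (cell_up c) = cell_up (globe_bd True k c)"
  "ocomp (path_cell n) k (cell_up c) (cell_up d) = cell_up (globe_comp k c d)"
  by (auto simp: path_omega_cat_def free_cell_def cell_up_def globe_bd_def globe_comp_def)

abbreviation nerve_functors :: "nat \<Rightarrow> nat \<Rightarrow> (nat set set \<Rightarrow> nat \<times> bool) set" where
  "nerve_functors n m \<equiv> omega_functors (simplex m) (path_cell n)"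

lemma nerve_functorD:
  assumes F: "F \<in> nerve_functors n m" and X: "simplex_cell m X s t"
  shows "F X \<in> carrier (path_cell n)" "cell_up (cell_down (F X)) = F X"
    "cell_down (F (s k)) = globe_bd False k (cell_down (F X))"
    "cell_down (F (t k)) = globe_bd True k (cell_down (F X))"
    "simplex_cell m Y s' t' \<Longrightarrow> t p = s' p \<Longrightarrow>
       cell_down (F (X \<union> Y)) = globe_comp p (cell_down (F X)) (cell_down (F Y))"
proof -
  have c: "X \<in> carrier (simplex m)" using X by (auto simp: carrier_simplex)
  have mem: "F Z \<in> carrier (path_cell n)" if "Z \<in> carrier (simplex m)" for Z
    using F that unfolding omega_functors_def by (auto dest: PiE_mem)
  have ud: "cell_up (cell_down (F Z)) = F Z" if "Z \<in> carrier (simplex m)" for Z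
    using cell_up_down[OF mem[OF that]] .
  show "F X \<in> carrier (path_cell n)" "cell_up (cell_down (F X)) = F X"
    using mem ud c by blast+
  have "F (osrc (simplex m) k X) = osrc (path_cell n) k (F X)"
    "F (otgt (simplex m) k X) = otgt (path_cell n) k (F X)"
    using F c unfolding omega_functors_def by auto
  then have "F (s k) = osrc (path_cell n) k (F X)" "F (t k) = otgt (path_cell n) k (F X)"
    by (simp_all add: simplex_src_tgt[OF X])
  then show "cell_down (F (s k)) = globe_bd False k (cell_down (F X))"
    "cell_down (F (t k)) = globe_bd True k (cell_down (F X))"
    using path_cell_ops(1,2)[of n k "cell_down (F X)"] ud[OF c] by simp_all
  show "cell_down (F (X \<union> Y)) = globe_comp p (cell_down (F X)) (cell_down (F Y))"
    if Y: "simplex_cell m Y s' t'" and XY: "t p = s' p"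
  proof -
    have cY: "Y \<in> carrier (simplex m)" using Y by (auto simp: carrier_simplex)
    have "F (ocomp (simplex m) p X Y) = ocomp (path_cell n) p (F X) (F Y)"
      using F c cY XY simplex_src_tgt[OF X, of p] simplex_src_tgt[OF Y, of p]
      unfolding omega_functors_def by auto
    moreover have "ocomp (simplex m) p X Y = X \<union> Y" by (simp add: simplex_def)
    ultimately show ?thesis
      using path_cell_ops(3)[of n p "cell_down (F X)" "cell_down (F Y)"] ud[OF c] ud[OF cY] by simp
  qed
qed

definition label :: "(nat set set \<Rightarrow> nat \<times> bool) \<Rightarrow> nat set \<Rightarrow> nat \<times> bool" where
  "label F x = cell_down (F (subfaces x))"

lemma subfaces_decomp: "subfaces x \<subseteq> insert x (Subfaces (src_faces x) \<union> Subfaces (tgt_faces x))"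
proof
  fix y assume y: "y \<in> subfaces x"
  show "y \<in> insert x (Subfaces (src_faces x) \<union> Subfaces (tgt_faces x))"
  proof (cases "y = x")
    case False
    then obtain a where "a \<in> x" "y \<subseteq> x - {a}" "y \<noteq> {}" using y by (auto simp: subfaces_def)
    then show ?thesis
      unfolding Subfaces_def subfaces_def src_faces_def tgt_faces_def by blast
  qed simp
qed

text \<open>The counterpart of \<open>simplex_cell_labels\<close> with functoriality given: by
  induction on the generation of \<open>X\<close>, the value at a composite is the larger of the
  values at its factors. Hence a functor is determined by its labels.\<close>

lemma is_top_label:
  assumes F: "F \<in> nerve_functors n m" and X: "simplex_cell m X s t"
  shows "is_top (label F ` X) (cell_down (F X))"
  using X
proof (induction rule: simplex_cell.induct)
  case (vertex x)
  have "finite x" "x \<noteq> {}" using vertex(1) faces_finite by blast+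
  then have "card x = 1" using vertex(2) card_gt_0_iff[of x] by (simp add: face_dim_def)
  then obtain a where "x = {a}" using card_1_singletonE by blast
  then have "subfaces x = {x}" by (auto simp: subfaces_def)
  then show ?case by (simp add: label_def is_top_def)
next
  case (face x p s t s' t')
  define S where "S = (\<lambda>k. if p \<le> k then subfaces x else if k = p - 1 then Subfaces (src_faces x) else s k)"
  define T where "T = (\<lambda>k. if p \<le> k then subfaces x else if k = p - 1 then Subfaces (tgt_faces x) else t' k)"
  have cell: "simplex_cell m (subfaces x) S T"
    unfolding S_def T_def using face.hyps by (rule simplex_cell.face)
  have ST: "S (p - 1) = Subfaces (src_faces x)" "T (p - 1) = Subfaces (tgt_faces x)"
    using face.hyps(3) by (auto simp: S_def T_def)
  define c where "c = cell_down (F (subfaces x))"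
  have le: "cell_le (label F y) c" if "y \<in> Subfaces (src_faces x) \<union> Subfaces (tgt_faces x)" for y
  proof -
    have "is_top (label F ` Subfaces (src_faces x)) (globe_bd False (p - 1) c)"
      "is_top (label F ` Subfaces (tgt_faces x)) (globe_bd True (p - 1) c)"
      using face.IH nerve_functorD(3,4)[OF F cell, of "p - 1", unfolded ST] by (simp_all only: c_def)
    then have "cell_le (label F y) (globe_bd False (p - 1) c) \<or> cell_le (label F y) (globe_bd True (p - 1) c)"
      using that unfolding is_top_def by blast
    then show ?thesis using cell_le_trans cell_le_globe_bd by blast
  qed
  have x: "x \<in> subfaces x" using face.hyps(1) faces_finite(2) subfaces_self by blast
  have cx: "label F x = c" by (simp add: label_def c_def)
  show ?case
    unfolding c_def[symmetric]
  proof (rule is_topI)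
    show "c \<in> label F ` subfaces x" using x cx by blast
    show "cell_le c' c" if c': "c' \<in> label F ` subfaces x" for c'
    proof -
      obtain y where "c' = label F y" "y \<in> subfaces x" using c' by blast
      then show ?thesis using subfaces_decomp[of x] le[of y] cx by auto
    qed
  qed
next
  case (comp X s t Y s' t' p)
  have "globe_bd True p (cell_down (F X)) = globe_bd False p (cell_down (F Y))"
    using nerve_functorD(4)[OF F comp.hyps(1), of p] nerve_functorD(3)[OF F comp.hyps(2), of p]
      comp.hyps(3) by simp
  from is_top_Un[OF comp.IH this] show ?case
    using nerve_functorD(5)[OF F comp.hyps(1,2,3)] by (simp add: image_Un)
qed

lemma labelling_at_label:
  assumes F: "F \<in> nerve_functors n m" and x: "x \<in> faces_of_cells m"
  shows "labelling_at (label F) x" "cell_up (label F x) \<in> carrier (path_cell n)"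
proof -
  obtain s t where c: "x \<in> faces m" "simplex_cell m (subfaces x) s t"
    "\<And>k. face_dim x \<le> k \<Longrightarrow> s k = subfaces x" "\<And>k. face_dim x \<le> k \<Longrightarrow> t k = subfaces x"
    "1 \<le> face_dim x \<Longrightarrow> s (face_dim x - 1) = Subfaces (src_faces x)"
    "1 \<le> face_dim x \<Longrightarrow> t (face_dim x - 1) = Subfaces (tgt_faces x)"
    using faces_of_cellsD[OF x] by blast
  note D = nerve_functorD[OF F c(2)]
  show "cell_up (label F x) \<in> carrier (path_cell n)"
    using D(1,2) by (simp add: label_def)
  \<comment> \<open>\<open>R(x)\<close> is its own source at level \<open>face_dim x\<close>, so its
    label is fixed by that source and has at most that dimension.\<close>
  have "label F x = globe_bd False (face_dim x) (label F x)"
    using D(3)[of "face_dim x"] c(3)[of "face_dim x"] by (simp add: label_def)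
  then have dim: "fst (label F x) \<le> face_dim x"
    by (metis fst_conv globe_bd_def le_refl not_le)
  have top: "is_top (label F ` subfaces x) (label F x)"
    using is_top_label[OF F c(2)] by (simp add: label_def)
  have "is_top (label F ` Subfaces (src_faces x)) (globe_bd False (face_dim x - 1) (label F x))"
    "is_top (label F ` Subfaces (tgt_faces x)) (globe_bd True (face_dim x - 1) (label F x))"
    if p: "1 \<le> face_dim x"
  proof -
    obtain u v u' v' where uv: "simplex_cell m (s (face_dim x - 1)) u v"
      "simplex_cell m (t (face_dim x - 1)) u' v'"
      using simplex_cell_bd[OF c(2)] unfolding carrier_simplex by blast
    show "is_top (label F ` Subfaces (src_faces x)) (globe_bd False (face_dim x - 1) (label F x))"
      "is_top (label F ` Subfaces (tgt_faces x)) (globe_bd True (face_dim x - 1) (label F x))"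
      using is_top_label[OF F uv(1)] is_top_label[OF F uv(2)] D(3,4)[of "face_dim x - 1"]
        c(5,6)[OF p] by (simp_all add: label_def)
  qed
  then show "labelling_at (label F) x"
    using dim top faces_finite(2)[OF c(1)] by (simp add: labelling_at_iff_top)
qed

definition top_of :: "(nat \<times> bool) set \<Rightarrow> nat \<times> bool" where
  "top_of S = (THE c. is_top S c)"

lemma top_of_eq: "is_top S c \<Longrightarrow> top_of S = c"
  unfolding top_of_def using is_top_unique by blast

definition functor_of :: "nat \<Rightarrow> (nat set \<Rightarrow> nat \<times> bool) \<Rightarrow> nat set set \<Rightarrow> nat \<times> bool" where
  "functor_of m v = (\<lambda>X\<in>carrier (simplex m). cell_up (top_of (v ` X)))"

lemma functor_of_in:
  assumes lab: "\<And>x. x \<in> faces_of_cells m \<Longrightarrow> labelling_at v x"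
    and mem: "\<And>x. x \<in> faces_of_cells m \<Longrightarrow> cell_up (v x) \<in> carrier (path_cell n)"
  shows "functor_of m v \<in> nerve_functors n m"
proof -
  have fX: "\<exists>c. is_top (v ` X) c \<and> functor_of m v X = cell_up c \<and> cell_up c \<in> carrier (path_cell n) \<and>
      (\<forall>k. functor_of m v (s k) = cell_up (globe_bd False k c) \<and>
        functor_of m v (t k) = cell_up (globe_bd True k c))"
    if X: "simplex_cell m X s t" for X s t
  proof -
    have C: "X \<in> carrier (simplex m)" using X by (auto simp: carrier_simplex)
    obtain c where c: "is_top (v ` X) c" "\<And>k. is_top (v ` s k) (globe_bd False k c)"
      "\<And>k. is_top (v ` t k) (globe_bd True k c)"
      using simplex_cell_labels[OF X] lab faces_of_cellsI[OF C] by blast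
    have "cell_up c \<in> carrier (path_cell n)"
      using c(1) mem faces_of_cellsI[OF C] by (auto simp: is_top_def)
    moreover have "functor_of m v X = cell_up c"
      "functor_of m v (s k) = cell_up (globe_bd False k c)"
      "functor_of m v (t k) = cell_up (globe_bd True k c)" for k
      using C simplex_cell_bd[OF X]
      by (simp_all add: functor_of_def top_of_eq[OF c(1)] top_of_eq[OF c(2)] top_of_eq[OF c(3)])
    ultimately show ?thesis using c(1) by blast
  qed
  show ?thesis
    unfolding omega_functors_def
  proof (intro CollectI conjI allI ballI impI PiE_I)
    fix X assume "X \<in> carrier (simplex m)"
    then obtain s t where X: "simplex_cell m X s t" by (auto simp: carrier_simplex)
    from fX[OF X] show "functor_of m v X \<in> carrier (path_cell n)" by auto
    show "functor_of m v (osrc (simplex m) k X) = osrc (path_cell n) k (functor_of m v X)"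
      "functor_of m v (otgt (simplex m) k X) = otgt (path_cell n) k (functor_of m v X)" for k
      using fX[OF X] by (auto simp: simplex_src_tgt[OF X] path_cell_ops)
    fix Y k assume "Y \<in> carrier (simplex m)" and XY: "otgt (simplex m) k X = osrc (simplex m) k Y"
    then obtain s' t' where Y: "simplex_cell m Y s' t'" by (auto simp: carrier_simplex)
    have st: "t k = s' k" using XY by (simp add: simplex_src_tgt[OF X] simplex_src_tgt[OF Y])
    obtain a where a: "is_top (v ` X) a" "functor_of m v X = cell_up a"
        "functor_of m v (t k) = cell_up (globe_bd True k a)"
      using fX[OF X] by blast
    obtain b where b: "is_top (v ` Y) b" "functor_of m v Y = cell_up b"
        "functor_of m v (s' k) = cell_up (globe_bd False k b)"
      using fX[OF Y] by blast
    have "cell_up (globe_bd True k a) = cell_up (globe_bd False k b)" using a(3) b(3) st by simp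
    then have ab: "globe_bd True k a = globe_bd False k b" by (metis cell_down_up)
    have "X \<union> Y \<in> carrier (simplex m)"
      using simplex_cell.comp[OF X Y st] by (auto simp: carrier_simplex)
    then have "functor_of m v (X \<union> Y) = cell_up (globe_comp k a b)"
      using is_top_Un[OF a(1) b(1) ab] by (simp add: functor_of_def image_Un top_of_eq)
    then show "functor_of m v (ocomp (simplex m) k X Y) =
        ocomp (path_cell n) k (functor_of m v X) (functor_of m v Y)"
      by (simp add: a(2) b(2) path_cell_ops simplex_def)
  qed (simp add: functor_of_def)
qed

lemma functor_of_label:
  assumes "F \<in> nerve_functors n m"
  shows "functor_of m (label F) = F"
proof (rule extensionalityI)
  show "F \<in> extensional (carrier (simplex m))" using assms by (auto simp: omega_functors_def PiE_def)
  fix X assume X: "X \<in> carrier (simplex m)"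
  then obtain s t where c: "simplex_cell m X s t" by (auto simp: carrier_simplex)
  show "functor_of m (label F) X = F X"
    using X is_top_label[OF assms c] nerve_functorD(2)[OF assms c]
    by (simp add: functor_of_def top_of_eq)
qed (simp add: functor_of_def)

section \<open>The extra degeneracy of the globular nerve\<close>

lemma strict_mono_coface: "strict_mono (coface i)"
  by (auto simp: strict_mono_def coface_def)

lemma simplex_cell_coface:
  assumes "simplex_cell m X s t"
  shows "simplex_cell (Suc m) ((`) (coface i) ` X) (\<lambda>k. (`) (coface i) ` s k) (\<lambda>k. (`) (coface i) ` t k)"
proof (rule simplex_cell_image[OF assms])
  show "strict_mono_on {..m} (coface i)"
    using strict_mono_coface by (auto simp: strict_mono_def monotone_on_def)
  show "coface i ` {..m} \<subseteq> {..Suc m}" by (auto simp: coface_def)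
  show "x \<subseteq> {..m}" if "x \<in> X" for x
    using simplex_cell_shape[OF assms] that by (auto simp: faces_def)
qed

lemma carrier_simplex_coface:
  "X \<in> carrier (simplex m) \<Longrightarrow> (`) (coface i) ` X \<in> carrier (simplex (Suc m))"
  using simplex_cell_coface unfolding carrier_simplex by blast

definition nerve_face :: "nat \<Rightarrow> nat \<Rightarrow> (nat set set \<Rightarrow> 'a) \<Rightarrow> nat set set \<Rightarrow> 'a" where
  "nerve_face m i F = (\<lambda>X\<in>carrier (simplex (m - 1)). F ((`) (coface i) ` X))"

lemma nerve_face_in:
  assumes F: "F \<in> omega_functors (simplex (Suc m)) D"
  shows "nerve_face (Suc m) i F \<in> omega_functors (simplex m) D"
  unfolding omega_functors_def
proof (intro CollectI conjI allI ballI impI PiE_I)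
  have F': "F Z \<in> carrier D" "F (osrc (simplex (Suc m)) k Z) = osrc D k (F Z)"
    "F (otgt (simplex (Suc m)) k Z) = otgt D k (F Z)" if "Z \<in> carrier (simplex (Suc m))" for Z k
    using F that unfolding omega_functors_def by (auto dest: PiE_mem)
  fix X assume X: "X \<in> carrier (simplex m)"
  then obtain s t where c: "simplex_cell m X s t" by (auto simp: carrier_simplex)
  note ci = simplex_cell_coface[OF c, of i]
  note iX = carrier_simplex_coface[OF X, of i]
  show "nerve_face (Suc m) i F X \<in> carrier D"
    using X F'(1)[OF iX] by (simp add: nerve_face_def)
  show "nerve_face (Suc m) i F (osrc (simplex m) k X) = osrc D k (nerve_face (Suc m) i F X)"
    "nerve_face (Suc m) i F (otgt (simplex m) k X) = otgt D k (nerve_face (Suc m) i F X)" for k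
    using X F'(2,3)[OF iX, of k] simplex_cell_bd[OF c, of k]
    by (simp_all add: nerve_face_def simplex_src_tgt[OF c] simplex_src_tgt[OF ci])
  fix Y k assume Y: "Y \<in> carrier (simplex m)" and XY: "otgt (simplex m) k X = osrc (simplex m) k Y"
  then obtain s' t' where c': "simplex_cell m Y s' t'" by (auto simp: carrier_simplex)
  note ci' = simplex_cell_coface[OF c', of i]
  note iY = carrier_simplex_coface[OF Y, of i]
  have st: "t k = s' k" using XY by (simp add: simplex_src_tgt[OF c] simplex_src_tgt[OF c'])
  have "otgt (simplex (Suc m)) k ((`) (coface i) ` X) = osrc (simplex (Suc m)) k ((`) (coface i) ` Y)"
    by (simp add: simplex_src_tgt[OF ci] simplex_src_tgt[OF ci'] st)
  then have "F (ocomp (simplex (Suc m)) k ((`) (coface i) ` X) ((`) (coface i) ` Y)) =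
      ocomp D k (F ((`) (coface i) ` X)) (F ((`) (coface i) ` Y))"
    using F iX iY unfolding omega_functors_def by auto
  moreover have "X \<union> Y \<in> carrier (simplex m)"
    using simplex_cell.comp[OF c c' st] by (auto simp: carrier_simplex)
  ultimately show "nerve_face (Suc m) i F (ocomp (simplex m) k X Y) =
      ocomp D k (nerve_face (Suc m) i F X) (nerve_face (Suc m) i F Y)"
    using X Y by (simp add: nerve_face_def simplex_def image_Un)
qed (simp add: nerve_face_def)

lemma nerve_face_nerve_face:
  assumes "i < j"
  shows "nerve_face (Suc m) i (nerve_face (Suc (Suc m)) j F) =
    nerve_face (Suc m) (j - 1) (nerve_face (Suc (Suc m)) i F)"
proof -
  have "coface j (coface i a) = coface i (coface (j - 1) a)" for a
    using assms by (auto simp: coface_def)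
  then have "coface j ` coface i ` x = coface i ` coface (j - 1) ` x" for x
    by (simp add: image_image)
  then have "(`) (coface j) ` (`) (coface i) ` X = (`) (coface i) ` (`) (coface (j - 1)) ` X" for X
    by (simp add: image_image)
  then show ?thesis
    unfolding nerve_face_def using carrier_simplex_coface[of _ m]
    by (intro restrict_ext) simp
qed

lemma label_nerve_face:
  assumes "x \<in> faces_of_cells m"
  shows "label (nerve_face (Suc m) i F) x = label F (coface i ` x)"
proof -
  show ?thesis
    using faces_of_cells_simps(2)[OF assms] by (simp add: label_def nerve_face_def subfaces_image)
qed

text \<open>The part of \<open>x\<close> off \<open>0\<close> is a subface and spans a cell all of
  whose faces avoid \<open>0\<close>; the downward shift carries the derivation of that cell to the
  smaller simplex.\<close>

lemma faces_of_cells_vimage_Suc: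
  assumes x: "x \<in> faces_of_cells (Suc m)" and ne: "Suc -` x \<noteq> {}"
  shows "Suc -` x \<in> faces_of_cells m"
proof -
  obtain s t where c: "x \<in> faces (Suc m)" "simplex_cell (Suc m) (subfaces x) s t"
    using faces_of_cells_simps[OF x] by (auto simp: carrier_simplex)
  define y where "y = Suc ` (Suc -` x)"
  have "y \<in> subfaces x" using ne by (auto simp: y_def subfaces_def)
  then obtain s t where y: "y \<in> faces (Suc m)" "simplex_cell (Suc m) (subfaces y) s t"
    using simplex_cell_face[OF c(2)] by blast
  have "simplex_cell m ((`) (\<lambda>i. i - 1) ` subfaces y) (\<lambda>k. (`) (\<lambda>i. i - 1) ` s k) (\<lambda>k. (`) (\<lambda>i. i - 1) ` t k)"
  proof (rule simplex_cell_image[OF y(2)])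
    show "strict_mono_on {1..Suc m} (\<lambda>i. i - 1)" by (auto simp: monotone_on_def)
    show "(\<lambda>i. i - 1) ` {1..Suc m} \<subseteq> {..m}" by auto
    show "z \<subseteq> {1..Suc m}" if "z \<in> subfaces y" for z
    proof -
      have "z \<subseteq> y" "y \<subseteq> {..Suc m}" using that y(1) by (auto simp: subfaces_def faces_def)
      moreover have "y \<subseteq> {1..}" by (auto simp: y_def)
      ultimately show ?thesis by fastforce
    qed
  qed
  then have "(`) (\<lambda>i. i - 1) ` subfaces y \<in> carrier (simplex m)" by (auto simp: carrier_simplex)
  moreover have "(\<lambda>i. i - 1) ` Suc ` r = r" for r by (simp add: image_image)
  then have "(\<lambda>i. i - 1) ` y = Suc -` x" unfolding y_def .
  then have "Suc -` x \<in> (`) (\<lambda>i. i - 1) ` subfaces y"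
    using subfaces_self[OF faces_finite(2)[OF y(1)]] by blast
  ultimately show ?thesis by (rule faces_of_cellsI)
qed

definition cone_functor :: "nat \<Rightarrow> (nat set set \<Rightarrow> nat \<times> bool) \<Rightarrow> nat set set \<Rightarrow> nat \<times> bool" where
  "cone_functor m F = functor_of (Suc m) (label_cone (label F))"

lemma vertex_in_simplex: "subfaces {0} \<in> carrier (simplex m)"
  using simplex_cell.vertex[of "{0}" m] by (auto simp: carrier_simplex faces_def face_dim_def)

lemma cone_functor_in:
  assumes F: "F \<in> nerve_functors n m"
  shows "cone_functor m F \<in> nerve_functors n (Suc m)"
  unfolding cone_functor_def
proof (rule functor_of_in)
  fix x assume x: "x \<in> faces_of_cells (Suc m)"
  then have "x \<in> faces (Suc m)" by (rule faces_of_cells_simps)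
  then have fin: "finite x" "x \<noteq> {}" using faces_finite by blast+
  show "labelling_at (label_cone (label F)) x"
    using fin labelling_at_label(1)[OF F faces_of_cells_vimage_Suc[OF x]]
    by (rule labelling_at_label_cone)
  \<comment> \<open>A functor on a simplex has a value at \<open>{{0}}\<close>, so the path category
    has a cell, and then it also contains the apex label \<open>t_0\<close>.\<close>
  have n: "n > 0"
  proof -
    have "F (subfaces {0}) \<in> carrier (path_cell n)"
      using nerve_functorD(1)[OF F] vertex_in_simplex[of m] unfolding carrier_simplex by blast
    then show ?thesis by (auto simp: carrier_path_cell)
  qed
  have base: "cell_up (0, True) \<in> carrier (path_cell n)"
    using n by (auto simp: carrier_path_cell cell_up_def)
  \<comment> \<open>The only cell of top dimension is the generator, coded with \<open>True\<close>.
    Raising a source to a cell with \<open>True\<close> therefore never leaves the globe, even from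
    just below the top.\<close>
  have lift: "cell_up (cone_cell c) \<in> carrier (path_cell n)" if "cell_up c \<in> carrier (path_cell n)" for c
    using that by (cases c) (auto simp: carrier_path_cell cell_up_def cone_cell_def)
  show "cell_up (label_cone (label F) x) \<in> carrier (path_cell n)"
  proof (cases x rule: nat_set_cases)
    case (Suc r)
    then have "r \<noteq> {}" using fin by auto
    then show ?thesis
      using Suc labelling_at_label(2)[OF F faces_of_cells_vimage_Suc[OF x]] by simp
  next
    case (insert r)
    then show ?thesis
      using base lift labelling_at_label(2)[OF F faces_of_cells_vimage_Suc[OF x]]
      by (cases "r = {}") simp_all
  qed
qed

lemma coface_0: "coface 0 = Suc"
  by (auto simp: coface_def)

lemma coface_Suc_image:
  "coface (Suc i) ` Suc ` r = Suc ` coface i ` r"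
  "coface (Suc i) ` insert 0 (Suc ` r) = insert 0 (Suc ` coface i ` r)"
  by (auto simp: coface_def image_iff)

lemma nerve_face_0_cone_functor:
  assumes F: "F \<in> nerve_functors n m"
  shows "nerve_face (Suc m) 0 (cone_functor m F) = F"
proof -
  have "label_cone (label F) ` (`) Suc ` X = label F ` X" for X
    by (simp add: image_image)
  then have "nerve_face (Suc m) 0 (cone_functor m F) = functor_of m (label F)"
    unfolding nerve_face_def cone_functor_def functor_of_def coface_0
    using carrier_simplex_coface[of _ m 0] by (intro ext) (simp add: coface_0)
  then show ?thesis using functor_of_label[OF F] by simp
qed

text \<open>Cofaces of positive index fix \<open>0\<close> and act on the base with the index
  lowered by one, so the two sides already agree on labels.\<close>

lemma nerve_face_Suc_cone_functor:
  "nerve_face (Suc (Suc m)) (Suc i) (cone_functor (Suc m) F) =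
     cone_functor m (nerve_face (Suc m) i F)"
proof -
  have "label_cone (label F) (coface (Suc i) ` x) = label_cone (label (nerve_face (Suc m) i F)) x"
    if x: "x \<in> faces_of_cells (Suc m)" for x
  proof (cases x rule: nat_set_cases)
    case (Suc r)
    have "x \<noteq> {}" using faces_of_cells_simps(1)[OF x] by (rule faces_finite)
    then have "r \<in> faces_of_cells m" using faces_of_cells_vimage_Suc[OF x] Suc by auto
    then show ?thesis by (simp add: Suc coface_Suc_image label_nerve_face)
  next
    case (insert r)
    show ?thesis
    proof (cases "r = {}")
      case True
      then show ?thesis using coface_Suc_image(2)[of i r] by (simp add: insert)
    next
      case False
      then have "r \<in> faces_of_cells m" using faces_of_cells_vimage_Suc[OF x] insert by auto
      then show ?thesis using False by (simp only: insert coface_Suc_image label_nerve_face label_cone_simps image_is_empty not_False_eq_True)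
    qed
  qed
  then have "label_cone (label F) ` (`) (coface (Suc i)) ` X = label_cone (label (nerve_face (Suc m) i F)) ` X"
    if "X \<in> carrier (simplex (Suc m))" for X
    using faces_of_cellsI[OF that] unfolding image_image by (intro image_cong) auto
  then show ?thesis
    unfolding nerve_face_def[of "Suc (Suc m)"] cone_functor_def functor_of_def
    using carrier_simplex_coface[of _ "Suc m" "Suc i"] by (intro ext) simp
qed

lemma carrier_simplex_0: "X \<in> carrier (simplex 0) \<Longrightarrow> X = {{0}}"
proof -
  assume "X \<in> carrier (simplex 0)"
  then obtain s t where X: "simplex_cell 0 X s t" by (auto simp: carrier_simplex)
  have "X \<subseteq> {{0}}" using simplex_cell_shape[OF X] by (auto simp: faces_def)
  then show "X = {{0}}" using simplex_cell_nonempty[OF X] by blast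
qed

text \<open>The second end of the cone over a vertex is the apex, whose label \<open>t_0\<close> is
  the cell \<open>(1, True)\<close> before the shift of dimensions. This constant functor is the
  value of the contraction in degree -1.\<close>

lemma nerve_face_1_cone_functor:
  "nerve_face (Suc 0) (Suc 0) (cone_functor 0 F) = (\<lambda>X\<in>carrier (simplex 0). (1, True))"
proof -
  have "cone_functor 0 F ((`) (coface (Suc 0)) ` X) = (1, True)" if X: "X \<in> carrier (simplex 0)" for X
  proof -
    have "(`) (coface (Suc 0)) ` X = {{0}}" using carrier_simplex_0[OF X] by (simp add: coface_def)
    moreover have "is_top {(0, True)} (0, True)" by (simp add: is_top_def)
    ultimately show ?thesis
      using carrier_simplex_coface[OF X, of "Suc 0"]
      by (simp add: cone_functor_def functor_of_def top_of_eq cell_up_def)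
  qed
  then show ?thesis unfolding nerve_face_def by (intro ext) simp
qed

section \<open>Homology of an augmented simplicial set with an extra degeneracy\<close>

lemma trivial_group_Mod_self:
  assumes "group G"
  shows "trivial_group (G Mod carrier G)"
proof -
  interpret group G by fact
  have sub: "subgroup (carrier G) G" by (rule subgroup_self)
  have coset: "carrier G #>\<^bsub>G\<^esub> x = carrier G" if "x \<in> carrier G" for x
    using coset_join2[OF that sub that] .
  have "carrier G \<lhd> G"
    by (rule normal_invI[OF sub]) simp
  then have "group (G Mod carrier G)" by (rule normal.factorgroup_is_group)
  moreover have "carrier (G Mod carrier G) = {carrier G}"
    using coset one_closed unfolding carrier_FactGroup by blast
  ultimately show ?thesis by (simp add: trivial_group_def FactGroup_def)
qed

lemma boundary_add: "boundary X n (a + b) = boundary X n a + boundary X n b"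
  by (simp add: boundary_def frag_extend_add)

lemma boundary_diff: "boundary X n (a - b) = boundary X n a - boundary X n b"
  by (simp add: boundary_def frag_extend_diff)

lemma boundary_minus: "boundary X n (- a) = - boundary X n a"
  by (simp add: boundary_def frag_extend_minus)

lemma boundary_0: "boundary X n 0 = 0"
  by (simp add: boundary_def)

lemma boundary_Suc_of:
  "boundary X (int (Suc k)) (frag_of x) =
     (\<Sum>i\<le>Suc k. frag_cmul ((-1) ^ i) (frag_of (face_map X (Suc k) i x)))"
  by (simp add: boundary_def nat_add_distrib del: of_nat_Suc sum.atMost_Suc)

lemma boundary_0_of: "boundary X 0 (frag_of x) = frag_of (augmentation X x)"
  by (simp add: boundary_def)

lemma trivial_aug_homology:
  assumes "boundary X (n + 1) ` carrier (chains X (n + 1)) =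
    kernel (chains X n) (chains X (n - 1)) (boundary X n)"
  shows "trivial_group (aug_homology X n)"
proof -
  let ?G = "chains X n"
  let ?K = "kernel ?G (chains X (n - 1)) (boundary X n)"
  have "group ?G" by (simp add: chains_def)
  moreover have "subgroup ?K ?G"
  proof (rule group.subgroupI[OF \<open>group ?G\<close>])
    have "0 \<in> ?K" by (simp add: kernel_def chains_def boundary_0)
    then show "?K \<noteq> {}" by blast
    show "?K \<subseteq> carrier ?G" by (auto simp: kernel_def)
    show "inv\<^bsub>?G\<^esub> a \<in> ?K" if "a \<in> ?K" for a
      using that by (simp add: kernel_def chains_def boundary_minus)
    show "a \<otimes>\<^bsub>?G\<^esub> b \<in> ?K" if "a \<in> ?K" "b \<in> ?K" for a b
      using that keys_add[of a b] by (auto simp: kernel_def chains_def boundary_add)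
  qed
  ultimately have "group (?G\<lparr>carrier := ?K\<rparr>)"
    by (simp add: subgroup.subgroup_is_group)
  from trivial_group_Mod_self[OF this] show ?thesis
    unfolding aug_homology_def assms by simp
qed

text \<open>The pairing \<open>(j, i) \<mapsto> (i, j - 1)\<close> cancels the terms two by two.\<close>

lemma alternating_double_sum:
  fixes f :: "nat \<Rightarrow> nat \<Rightarrow> 'a \<Rightarrow>\<^sub>0 int"
  assumes "\<And>i j. i < j \<Longrightarrow> j \<le> Suc n \<Longrightarrow> f j i = f i (j - 1)"
  shows "(\<Sum>j\<le>Suc n. \<Sum>i\<le>n. frag_cmul ((-1) ^ (i + j)) (f j i)) = 0"
proof -
  define g where "g = (\<lambda>(j, i). frag_cmul ((-1) ^ (i + j)) (f j i))"
  define A where "A = {(j, i). i < j \<and> j \<le> Suc n}"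
  define B where "B = {(j, i). j \<le> i \<and> i \<le> n}"
  have fin: "finite A" "finite B"
    by (rule finite_subset[of _ "{..Suc n} \<times> {..Suc n}"]; auto simp: A_def B_def)+
  have split: "{..Suc n} \<times> {..n} = A \<union> B" "A \<inter> B = {}"
    by (auto simp: A_def B_def)
  have "sum g B = (\<Sum>p\<in>A. - g p)"
  proof (rule sum.reindex_bij_witness[where i = "\<lambda>(j, i). (i, j - 1)" and j = "\<lambda>(i, j). (Suc j, i)"])
    fix p assume "p \<in> B"
    then obtain a b where p: "p = (a, b)" "a \<le> b" "b \<le> n" by (auto simp: B_def)
    have "f (Suc b) a = f a b" using assms[of a "Suc b"] p by simp
    then show "- g ((\<lambda>(i, j). (Suc j, i)) p) = g p"
      by (simp add: g_def p add.commute)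
  qed (auto simp: A_def B_def)
  then have "sum g ({..Suc n} \<times> {..n}) = 0"
    unfolding split(1) sum.union_disjoint[OF fin split(2)] by (simp add: sum_negf)
  then show ?thesis
    unfolding g_def by (simp add: sum.cartesian_product del: sum.atMost_Suc)
qed

text \<open>The map \<open>h\<close> is an extra degeneracy placed before the first vertex. Since
  the augmentation takes only the value \<open>e\<close>, the simplex \<open>b\<close> serves as the
  value of \<open>h\<close> at \<open>e\<close>.\<close>

locale contractible_aug_sset =
  fixes X :: "'x aug_sset" and h :: "nat \<Rightarrow> 'x \<Rightarrow> 'x" and e b :: 'x
  assumes face_in: "\<And>k i x. x \<in> simplices X (int (Suc k)) \<Longrightarrow> i \<le> Suc k \<Longrightarrow>
      face_map X (Suc k) i x \<in> simplices X (int k)"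
    and face_face: "\<And>k i j x. x \<in> simplices X (int (Suc (Suc k))) \<Longrightarrow> i < j \<Longrightarrow> j \<le> Suc (Suc k) \<Longrightarrow>
      face_map X (Suc k) i (face_map X (Suc (Suc k)) j x) =
      face_map X (Suc k) (j - 1) (face_map X (Suc (Suc k)) i x)"
    and aug: "\<And>x. x \<in> simplices X 0 \<Longrightarrow> augmentation X x = e"
    and h_in: "\<And>k x. x \<in> simplices X (int k) \<Longrightarrow> h k x \<in> simplices X (int (Suc k))"
    and face_0_h: "\<And>k x. x \<in> simplices X (int k) \<Longrightarrow> face_map X (Suc k) 0 (h k x) = x"
    and face_Suc_h: "\<And>k i x. x \<in> simplices X (int (Suc k)) \<Longrightarrow> i \<le> Suc k \<Longrightarrow>
      face_map X (Suc (Suc k)) (Suc i) (h (Suc k) x) = h k (face_map X (Suc k) i x)"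
    and face_1_h: "\<And>x. x \<in> simplices X 0 \<Longrightarrow> face_map X (Suc 0) (Suc 0) (h 0 x) = b"
begin

definition hom_h :: "nat \<Rightarrow> ('x \<Rightarrow>\<^sub>0 int) \<Rightarrow> 'x \<Rightarrow>\<^sub>0 int" where
  "hom_h k = frag_extend (\<lambda>x. frag_of (h k x))"

lemma hom_h_in: "Poly_Mapping.keys c \<subseteq> simplices X (int k) \<Longrightarrow>
    Poly_Mapping.keys (hom_h k c) \<subseteq> simplices X (int (Suc k))"
  unfolding hom_h_def by (rule order_trans[OF keys_frag_extend]) (use h_in in auto)

lemma boundary_in:
  assumes "Poly_Mapping.keys c \<subseteq> simplices X (int (Suc k))"
  shows "Poly_Mapping.keys (boundary X (int (Suc k)) c) \<subseteq> simplices X (int k)"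
  using assms
proof (induction c rule: frag_induction)
  case (one x)
  have "Poly_Mapping.keys (frag_cmul ((-1) ^ i) (frag_of (face_map X (Suc k) i x))) \<subseteq> simplices X (int k)"
    if "i \<le> Suc k" for i
    using face_in[OF one that] by auto
  then show ?case
    unfolding boundary_Suc_of by (intro order_trans[OF keys_sum]) blast
next
  case (diff a b)
  then show ?case unfolding boundary_diff using keys_diff[of "boundary X (int (Suc k)) a"] by blast
qed (simp add: boundary_0)

text \<open>The face of index 0 of \<open>h x\<close> returns \<open>x\<close>; the others are cones
  over the faces of \<open>x\<close> with the index raised by one, which accounts for the minus
  sign.\<close>

lemma homotopy_Suc:
  assumes "Poly_Mapping.keys c \<subseteq> simplices X (int (Suc k))"
  shows "boundary X (int (Suc (Suc k))) (hom_h (Suc k) c) = c - hom_h k (boundary X (int (Suc k)) c)"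
  using assms
proof (induction c rule: frag_induction)
  case (one x)
  have "boundary X (int (Suc (Suc k))) (hom_h (Suc k) (frag_of x)) =
      frag_of x + (\<Sum>i\<le>Suc k. frag_cmul ((-1) ^ Suc i) (frag_of (h k (face_map X (Suc k) i x))))"
    unfolding hom_h_def frag_extend_of boundary_Suc_of[of X "Suc k"] sum.atMost_Suc_shift[of _ "Suc k"]
    using face_0_h[OF one] face_Suc_h[OF one] by simp
  also have "(\<Sum>i\<le>Suc k. frag_cmul ((-1) ^ Suc i) (frag_of (h k (face_map X (Suc k) i x)))) =
      - hom_h k (boundary X (int (Suc k)) (frag_of x))"
    unfolding boundary_Suc_of hom_h_def frag_extend_sum[OF finite_atMost]
    by (simp add: frag_extend_cmul sum_negf[symmetric] del: sum.atMost_Suc)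
  finally show ?case by simp
next
  case (diff a b)
  then show ?case unfolding hom_h_def boundary_diff frag_extend_diff by simp
qed (simp add: boundary_0 hom_h_def)

text \<open>On a 0-chain the correction term is \<open>b\<close> times the sum of the coefficients;
  it vanishes on cycles of the augmentation.\<close>

lemma homotopy_0:
  assumes "Poly_Mapping.keys c \<subseteq> simplices X 0"
  shows "boundary X 1 (hom_h 0 c) = c - frag_extend (\<lambda>_. frag_of b) (boundary X 0 c)"
  using assms
proof (induction c rule: frag_induction)
  case (one x)
  then show ?case
    using boundary_Suc_of[of X 0 "h 0 x"] face_0_h[of x 0] face_1_h[of x]
    by (simp add: hom_h_def boundary_0_of)
next
  case (diff a b)
  then show ?case unfolding hom_h_def boundary_diff frag_extend_diff by simp
qed (simp add: boundary_0 hom_h_def)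

lemma boundary_boundary_Suc:
  assumes "Poly_Mapping.keys c \<subseteq> simplices X (int (Suc (Suc k)))"
  shows "boundary X (int (Suc k)) (boundary X (int (Suc (Suc k))) c) = 0"
  using assms
proof (induction c rule: frag_induction)
  case (one x)
  have sum: "boundary X n (\<Sum>i\<le>m. f i) = (\<Sum>i\<le>m. boundary X n (f i))" for n m and f :: "nat \<Rightarrow> _"
    by (induction m) (simp_all add: boundary_add)
  have cmul: "boundary X (int (Suc k)) (frag_cmul z a) = frag_cmul z (boundary X (int (Suc k)) a)" for z a
    by (simp add: boundary_def frag_extend_cmul)
  have "boundary X (int (Suc k)) (boundary X (int (Suc (Suc k))) (frag_of x)) =
    (\<Sum>j\<le>Suc (Suc k). \<Sum>i\<le>Suc k. frag_cmul ((-1) ^ (i + j))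
      (frag_of (face_map X (Suc k) i (face_map X (Suc (Suc k)) j x))))"
    unfolding boundary_Suc_of[of X "Suc k"] sum cmul boundary_Suc_of[of X k] frag_cmul_sum
    by (simp add: power_add mult.commute del: sum.atMost_Suc)
  also have "\<dots> = 0"
    by (rule alternating_double_sum) (simp add: face_face[OF one])
  finally show ?case .
next
  case (diff a b)
  then show ?case unfolding boundary_diff by simp
qed (simp add: boundary_0)

lemma boundary_boundary_0:
  assumes "Poly_Mapping.keys c \<subseteq> simplices X 1"
  shows "boundary X 0 (boundary X 1 c) = 0"
  using assms
proof (induction c rule: frag_induction)
  case (one x)
  then have "augmentation X (face_map X (Suc 0) i x) = e" if "i \<le> Suc 0" for i
    using aug face_in[of x 0 i] that by simp
  then show ?case
    using boundary_Suc_of[of X 0 x] by (simp add: boundary_diff boundary_0_of)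
next
  case (diff a b)
  then show ?case unfolding boundary_diff by simp
qed (simp add: boundary_0)

theorem trivial_homology: "trivial_group (aug_homology X (int m))"
proof (rule trivial_aug_homology, intro equalityI subsetI)
  fix c assume "c \<in> boundary X (int m + 1) ` carrier (chains X (int m + 1))"
  then obtain d where d: "c = boundary X (int (Suc m)) d" "Poly_Mapping.keys d \<subseteq> simplices X (int (Suc m))"
    by (auto simp: chains_def add.commute)
  have "boundary X (int m) c = 0"
  proof (cases m)
    case 0
    then show ?thesis using d boundary_boundary_0[of d] by simp
  next
    case (Suc k)
    then show ?thesis using d boundary_boundary_Suc[of d k] by simp
  qed
  then show "c \<in> kernel (chains X (int m)) (chains X (int m - 1)) (boundary X (int m))"
    using boundary_in[OF d(2)] d(1) by (simp add: kernel_def chains_def)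
next
  fix c assume "c \<in> kernel (chains X (int m)) (chains X (int m - 1)) (boundary X (int m))"
  then have c: "Poly_Mapping.keys c \<subseteq> simplices X (int m)" "boundary X (int m) c = 0"
    by (auto simp: kernel_def chains_def)
  have "boundary X (int (Suc m)) (hom_h m c) = c"
  proof (cases m)
    case 0
    then show ?thesis using homotopy_0[of c] c by simp
  next
    case (Suc k)
    then show ?thesis using homotopy_Suc[of c k] c by (simp add: hom_h_def del: of_nat_Suc)
  qed
  then show "c \<in> boundary X (int m + 1) ` carrier (chains X (int m + 1))"
    using hom_h_in[OF c(1)] by (auto simp: chains_def add.commute intro!: image_eqI[of _ _ "hom_h m c"])
qed

end

section \<open>The globular nerve of the free cell\<close>

definition cone_simplex :: "nat \<Rightarrow> (nat \<times> bool) gl_simplex \<Rightarrow> (nat \<times> bool) gl_simplex" where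
  "cone_simplex k \<xi> = (case \<xi> of Simplex F \<Rightarrow> Simplex (cone_functor k F) | Endpoints a b \<Rightarrow> Endpoints a b)"

lemma globular_nerve_simplices:
  "simplices (globular_nerve C) (int k) = Simplex ` omega_functors (simplex k) (path_omega_cat C)"
  "simplices (globular_nerve C) 0 = Simplex ` omega_functors (simplex 0) (path_omega_cat C)"
  by (simp_all add: globular_nerve_def)

lemma globular_nerve_face:
  "face_map (globular_nerve C) k i (Simplex F) = Simplex (nerve_face k i F)"
  by (simp add: globular_nerve_def nerve_face_def)

text \<open>Every cell of positive dimension runs from the object \<open>(0, False)\<close> to
  \<open>(0, True)\<close>, so the augmentation is constant. For \<open>n = 0\<close> the path
  category is empty and there are no simplices in degrees from 0 on, so that the conditions hold
  vacuously.\<close>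

interpretation nerve: contractible_aug_sset "globular_nerve (free_cell n)" cone_simplex
  "Endpoints (0, False) (0, True)" "Simplex (\<lambda>X\<in>carrier (simplex 0). (1, True))"
proof (unfold_locales, goal_cases)
  case (1 k i x)
  then show ?case
    by (auto simp: globular_nerve_simplices globular_nerve_face nerve_face_in simp del: of_nat_Suc)
next
  case (2 k i j x)
  then show ?case
    using nerve_face_nerve_face[of i j k]
    by (auto simp: globular_nerve_simplices globular_nerve_face simp del: of_nat_Suc)
next
  case (3 x)
  then obtain F where F: "x = Simplex F" "F \<in> nerve_functors n 0"
    by (auto simp: globular_nerve_simplices)
  have "F (subfaces {0}) \<in> carrier (path_cell n)"
    using nerve_functorD(1)[OF F(2)] vertex_in_simplex[of 0] unfolding carrier_simplex by blast
  then have "0 < fst (F (subfaces {0}))" by (simp add: carrier_path_cell)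
  then show ?case by (simp add: F(1) globular_nerve_def free_cell_def)
next
  case (4 k x)
  then show ?case
    using cone_functor_in by (auto simp: globular_nerve_simplices cone_simplex_def simp del: of_nat_Suc)
next
  case (5 k x)
  then show ?case
    using nerve_face_0_cone_functor
    by (auto simp: globular_nerve_simplices globular_nerve_face cone_simplex_def simp del: of_nat_Suc)
next
  case (6 k i x)
  then show ?case
    by (auto simp: globular_nerve_simplices globular_nerve_face cone_simplex_def
        nerve_face_Suc_cone_functor simp del: of_nat_Suc)
next
  case (7 x)
  then show ?case
    by (auto simp: globular_nerve_simplices globular_nerve_face cone_simplex_def nerve_face_1_cone_functor)
qed

theorem theorem8p1:
  fixes p n :: nat
  assumes "p > 0"
  shows "trivial_group (globular_homology (free_cell n) p)"
proof -
  have "int p - 1 = int (p - 1)" using assms by simp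
  show ?thesis
    unfolding globular_homology_def \<open>int p - 1 = int (p - 1)\<close> by (rule nerve.trivial_homology)
qed

end
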